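(* Let $(L,\mathfrak m)$ be a (Noetherian) local ring with infinite residue field, $\mathfrak a=(a_1,\ldots,a_m)$ an ideal of $L$ with analytic spread $d$, and $\mathcal J\subseteq L[u]$ a testing ideal for the minimal reductions of $\mathfrak a$. Let $\mathfrak q$ be an ideal generated by $d$ elements of $\mathfrak a$ which is parameterized by $\alpha\in L^{md}$. Then $\mathfrak q$ is a minimal reduction of $\mathfrak a$ if and only if $\mathcal J_\alpha=L$.
   Context: An ideal $\mathfrak q\subseteq\mathfrak a$ is a reduction of $\mathfrak a$ if $\mathfrak a^{n+1}=\mathfrak q\mathfrak a^n$ for some $n\ge0$; the least such $n$ is $r_{\mathfrak q}(\mathfrak a)$. Minimal reductions are reductions minimal with respect to inclusion. The big reduction number $br(\mathfrak a)$ is the maximum of $r_{\mathfrak q}(\mathfrak a)$ over all minimal reductions $\mathfrak q$ of $\mathfrak a$ (it is finite). The analytic spread of $\mathfrak a$ is $d=\dim\bigoplus_{n\ge0}\mathfrak a^n/\mathfrak m\mathfrak a^n$. An ideal $\mathfrak q=(c_1,\ldots,c_d)$ is parameterized by $\alpha=(\alpha_{ij})\in L^{md}$ if $c_i=\sum_{j=1}^m\alpha_{ij}a_j$ for $i=1,\ldots,d$. Testing ideal: let $u=\{u_{ij}\mid 1\le i\le d,\ 1\le j\le m\}$ be indeterminates and $b_i=\sum_{j=1}^m u_{ij}a_j\in L[u]$ (the generic elements of $\mathfrak a$). Fix a minimal basis of $\mathfrak a^{br(\mathfrak a)+1}$ consisting of monomials of degree $br(\mathfrak a)+1$ in $a_1,\ldots,a_m$.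 Write each element $b_ig$ ($i=1,\ldots,d$, $g$ a monomial in $a_1,\ldots,a_m$ of degree $br(\mathfrak a)$) as a linear combination of the elements of this basis with coefficients in $L[u]$, and let $M$ be the matrix of these coefficients. Let $h$ be the minimal number of generators of $\mathfrak a^{br(\mathfrak a)+1}$. The testing ideal $\mathcal J$ is the ideal of $L[u]$ generated by the $h\times h$ minors of $M$. For $\alpha\in L^{md}$, $\mathcal J_\alpha=\{f(\alpha)\mid f\in\mathcal J\}$ is the ideal of $L$ obtained from $\mathcal J$ by the specialization $u\to\alpha$. *)

theory Defs
  imports
    "HOL-Library.Poly_Mapping"
    "HOL-Library.Extended_Nat"
    "HOL-Algebra.Ideal_Product"
    "HOL-Algebra.QuotRing"
    "HOL-Algebra.Ring_Divisibility"
    "Jordan_Normal_Form.DL_Submatrix"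
    "Jordan_Normal_Form.Determinant"
    "Jordan_Normal_Form.VS_Connect"
begin

hide_const (open) Multiset.mult

section \<open>Local rings, generators, Krull dimension\<close>

definition local_ring :: "('a, 'b) ring_scheme \<Rightarrow> 'a set \<Rightarrow> bool" where
  "local_ring R \<mm> \<longleftrightarrow> cring R \<and> maximalideal \<mm> R \<and> (\<forall>N. maximalideal N R \<longrightarrow> N = \<mm>)"

definition ideal_pow :: "('a, 'b) ring_scheme \<Rightarrow> 'a set \<Rightarrow> nat \<Rightarrow> 'a set" where
  "ideal_pow R A n = A [^]\<^bsub>ideals_set R\<^esub> n"

definition min_num_gens :: "('a, 'b) ring_scheme \<Rightarrow> 'a set \<Rightarrow> nat" where
  "min_num_gens R I = (LEAST n. \<exists>S. S \<subseteq> carrier R \<and> finite S \<and> card S = n \<and> genideal R S = I)"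

definition minimal_basis :: "('a, 'b) ring_scheme \<Rightarrow> 'a set \<Rightarrow> 'a list \<Rightarrow> bool" where
  "minimal_basis R I B \<longleftrightarrow> distinct B \<and> set B \<subseteq> carrier R \<and> genideal R (set B) = I \<and>
     (\<forall>S. S \<subset> set B \<longrightarrow> genideal R S \<noteq> I)"

text \<open>The length of a chain is its number of strict inclusions; the zero ring gets dimension \<open>0\<close>.\<close>

definition krull_dim :: "('a, 'b) ring_scheme \<Rightarrow> enat" where
  "krull_dim R = Sup {enat n | n. \<exists>P. (\<forall>i\<le>n. primeideal (P i) R) \<and> (\<forall>i<n. P i \<subset> P (Suc i))}"


section \<open>Reductions\<close>

definition reduction :: "('a, 'b) ring_scheme \<Rightarrow> 'a set \<Rightarrow> 'a set \<Rightarrow> bool" where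
  "reduction R Q A \<longleftrightarrow> ideal Q R \<and> Q \<subseteq> A \<and>
     (\<exists>n. ideal_pow R A (n + 1) = ideal_prod R Q (ideal_pow R A n))"

definition reduction_number :: "('a, 'b) ring_scheme \<Rightarrow> 'a set \<Rightarrow> 'a set \<Rightarrow> nat" where
  "reduction_number R Q A = (LEAST n. ideal_pow R A (n + 1) = ideal_prod R Q (ideal_pow R A n))"

definition minimal_reduction :: "('a, 'b) ring_scheme \<Rightarrow> 'a set \<Rightarrow> 'a set \<Rightarrow> bool" where
  "minimal_reduction R Q A \<longleftrightarrow> reduction R Q A \<and> (\<forall>Q'. reduction R Q' A \<and> Q' \<subseteq> Q \<longrightarrow> Q' = Q)"

text \<open>Minimal reductions exist and their reduction numbers are bounded when \<open>R\<close> is a Noetherian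
  local ring with infinite residue field, so the maximum is meaningful there.\<close>

definition big_reduction_number :: "('a, 'b) ring_scheme \<Rightarrow> 'a set \<Rightarrow> nat" where
  "big_reduction_number R A = Max {reduction_number R Q A | Q. minimal_reduction R Q A}"


section \<open>Analytic spread\<close>

text \<open>The fiber cone \<open>\<Oplus>\<^sub>n A\<^sup>n / \<mm>A\<^sup>n\<close>: an element is a finitely supported family whose
  \<open>n\<close>-th component is a coset of \<open>\<mm>A\<^sup>n\<close> represented by an element of \<open>A\<^sup>n\<close>.
  As \<open>A\<^sup>n / \<mm>A\<^sup>n\<close> is an additive subgroup of \<open>R / \<mm>A\<^sup>n\<close>, components are added there;
  the degree-\<open>n\<close> component of a product is the sum of the cosets of the products \<open>x y\<close>
  with \<open>x\<close>, \<open>y\<close> from the components of complementary degrees \<open>i\<close> and \<open>n - i\<close>.\<close>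

definition fiber_cone :: "('a, 'b) ring_scheme \<Rightarrow> 'a set \<Rightarrow> 'a set \<Rightarrow> (nat \<Rightarrow> 'a set) ring" where
  "fiber_cone R \<mm> A = (let I = (\<lambda>n. ideal_prod R \<mm> (ideal_pow R A n)) in
     \<lparr>carrier = {f. (\<forall>n. f n \<in> (\<lambda>x. I n +>\<^bsub>R\<^esub> x) ` ideal_pow R A n) \<and> finite {n. f n \<noteq> I n}},
      mult = (\<lambda>f g n. finsum (R Quot I n) (\<lambda>i. rcoset_mult R (I n) (f i) (g (n - i))) {..n}),
      one = (\<lambda>n. I n +>\<^bsub>R\<^esub> (if n = 0 then \<one>\<^bsub>R\<^esub> else \<zero>\<^bsub>R\<^esub>)),
      zero = I,
      add = (\<lambda>f g n. f n \<oplus>\<^bsub>R Quot I n\<^esub> g n)\<rparr>)"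

definition analytic_spread :: "('a, 'b) ring_scheme \<Rightarrow> 'a set \<Rightarrow> 'a set \<Rightarrow> enat" where
  "analytic_spread R \<mm> A = krull_dim (fiber_cone R \<mm> A)"


section \<open>Polynomials in several indeterminates\<close>

text \<open>A polynomial maps exponent vectors (finitely supported maps from the indeterminates
  to \<open>\<nat>\<close>) to coefficients.\<close>

type_synonym ('v, 'a) mpoly = "('v \<Rightarrow>\<^sub>0 nat) \<Rightarrow>\<^sub>0 'a"

definition mpoly_const :: "'a::comm_ring_1 \<Rightarrow> ('v, 'a) mpoly" where
  "mpoly_const c = Poly_Mapping.single 0 c"

definition mpoly_var :: "'v \<Rightarrow> ('v, 'a::comm_ring_1) mpoly" where
  "mpoly_var v = Poly_Mapping.single (Poly_Mapping.single v 1) 1"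

definition mpoly_ring :: "'v set \<Rightarrow> ('v, 'a::comm_ring_1) mpoly ring" where
  "mpoly_ring V = class_ring\<lparr>carrier :=
     {p. \<forall>t \<in> Poly_Mapping.keys p. Poly_Mapping.keys t \<subseteq> V}\<rparr>"

definition mpoly_eval :: "('v \<Rightarrow> 'a) \<Rightarrow> ('v, 'a::comm_ring_1) mpoly \<Rightarrow> 'a" where
  "mpoly_eval \<alpha> p = (\<Sum>t\<in>Poly_Mapping.keys p. Poly_Mapping.lookup p t *
     (\<Prod>v\<in>Poly_Mapping.keys t. \<alpha> v ^ Poly_Mapping.lookup t v))"


section \<open>Testing ideals\<close>

text \<open>The ring \<open>L\<close> is the type \<open>'a\<close>, viewed as an algebraic structure through \<open>class_ring\<close>.
  Generators \<open>a\<^sub>j\<close> and indeterminates \<open>u\<^sub>i\<^sub>j\<close> are indexed from \<open>0\<close>, i.e. \<open>i < d\<close> and \<open>j < m\<close>.\<close>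

definition ideal_gen_by :: "nat \<Rightarrow> (nat \<Rightarrow> 'a::comm_ring_1) \<Rightarrow> 'a set" where
  "ideal_gen_by m a = genideal class_ring (a ` {..<m})"

definition generic_element :: "nat \<Rightarrow> (nat \<Rightarrow> 'a::comm_ring_1) \<Rightarrow> nat \<Rightarrow> (nat \<times> nat, 'a) mpoly" where
  "generic_element m a i = (\<Sum>j<m. mpoly_var (i, j) * mpoly_const (a j))"

text \<open>A monomial of degree \<open>n\<close> in \<open>a\<^sub>0, \<dots>, a\<^sub>m\<^sub>-\<^sub>1\<close> is given by the multiset of the \<open>n\<close> indices
  of its factors.\<close>

definition monomial_value :: "(nat \<Rightarrow> 'a::comm_ring_1) \<Rightarrow> nat multiset \<Rightarrow> 'a" where
  "monomial_value a g = (\<Prod>j\<in>#g. a j)"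

definition minors :: "nat \<Rightarrow> 'a::comm_ring_1 mat \<Rightarrow> 'a set" where
  "minors h M = {det (submatrix M I K) | I K.
     I \<subseteq> {..<dim_row M} \<and> K \<subseteq> {..<dim_col M} \<and> card I = h \<and> card K = h}"

text \<open>\<open>B\<close> lists the chosen basis (the columns of \<open>M\<close>) and \<open>rs\<close> enumerates the pairs \<open>(i, g)\<close>
  (the rows of \<open>M\<close>). The coefficients in \<open>M\<close> are in general not uniquely determined,
  so an ideal may have several testing ideals.\<close>

definition testing_matrix ::
  "nat \<Rightarrow> nat \<Rightarrow> (nat \<Rightarrow> 'a::comm_ring_1) \<Rightarrow> 'a list \<Rightarrow> (nat \<times> nat multiset) list \<Rightarrow>
     (nat \<times> nat, 'a) mpoly mat \<Rightarrow> bool" where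
  "testing_matrix d m a B rs M \<longleftrightarrow>
    (let A = ideal_gen_by m a; r = big_reduction_number class_ring A in
      minimal_basis class_ring (ideal_pow class_ring A (r + 1)) B \<and>
      set B \<subseteq> monomial_value a ` multisets_of_size {..<m} (r + 1) \<and>
      distinct rs \<and> set rs = {..<d} \<times> multisets_of_size {..<m} r \<and>
      M \<in> carrier_mat (length rs) (length B) \<and>
      elements_mat M \<subseteq> carrier (mpoly_ring ({..<d} \<times> {..<m})) \<and>
      (\<forall>p<length rs. generic_element m a (fst (rs ! p)) * mpoly_const (monomial_value a (snd (rs ! p)))
         = (\<Sum>k<length B. M $$ (p, k) * mpoly_const (B ! k))))"

definition testing_ideal ::
  "nat \<Rightarrow> nat \<Rightarrow> (nat \<Rightarrow> 'a::comm_ring_1) \<Rightarrow> (nat \<times> nat, 'a) mpoly set \<Rightarrow> bool" where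
  "testing_ideal d m a J \<longleftrightarrow>
    (let A = ideal_gen_by m a; r = big_reduction_number class_ring A;
         h = min_num_gens class_ring (ideal_pow class_ring A (r + 1)) in
      \<exists>B rs M. testing_matrix d m a B rs M \<and>
        J = genideal (mpoly_ring ({..<d} \<times> {..<m})) (minors h M))"

definition specialize :: "(nat \<Rightarrow> nat \<Rightarrow> 'a::comm_ring_1) \<Rightarrow> (nat \<times> nat, 'a) mpoly set \<Rightarrow> 'a set" where
  "specialize \<alpha> J = mpoly_eval (\<lambda>(i, j). \<alpha> i j) ` J"

definition parameterized_ideal ::
  "nat \<Rightarrow> nat \<Rightarrow> (nat \<Rightarrow> 'a::comm_ring_1) \<Rightarrow> (nat \<Rightarrow> nat \<Rightarrow> 'a) \<Rightarrow> 'a set" where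
  "parameterized_ideal d m a \<alpha> = ideal_gen_by d (\<lambda>i. \<Sum>j<m. \<alpha> i j * a j)"

end

theory Submission
  imports Defs "HOL-Library.Function_Algebras" "HOL-Algebra.Subrings"
begin

text \<open>Let \<open>r\<close> be the big reduction number, \<open>c\<^sub>i = \<Sum>\<^sub>j \<alpha>\<^sub>i\<^sub>j a\<^sub>j\<close> the generators of \<open>Q\<close>, and \<open>M\<^sub>\<alpha>\<close> the specialized
  matrix, whose rows are the coordinates of the generators \<open>c\<^sub>i g\<close> of \<open>Q A\<^sup>r\<close>. Modulo \<open>\<mm>\<close> the chosen
  basis is linearly independent, so \<open>Q A\<^sup>r = A\<^sup>r\<^sup>+\<^sup>1\<close> holds if and only if some maximal minor of \<open>M\<^sub>\<alpha>\<close>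
  is a unit, that is, \<open>J\<^sub>\<alpha> = L\<close>.

  A minimal reduction satisfies \<open>Q A\<^sup>r = A\<^sup>r\<^sup>+\<^sup>1\<close> once reduction numbers are known to be bounded. Up to
  \<open>\<mm>A\<close>, every reduction is generated by \<open>m\<close> elements, and the parameters of those of reduction number
  at most \<open>n\<close> form an open set cut out by minors; Hilbert's basis theorem makes this
  increasing family of open sets stationary.

  Conversely, if \<open>Q A\<^sup>r = A\<^sup>r\<^sup>+\<^sup>1\<close> and a smaller reduction were contained in \<open>Q\<close>, then fewer than \<open>d\<close>
  elements would generate a reduction. Then the graded pieces of the fiber cone grow too slowly to
  allow a chain of \<open>d + 1\<close> primes, since the lifts of elements \<open>x\<^sub>i \<in> P\<^sub>i\<^sub>+\<^sub>1 - P\<^sub>i\<close> to the Rees algebra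
  have independent monomials modulo \<open>P\<^sub>0\<close>.\<close>

section \<open>Linear algebra over a local ring\<close>

text \<open>The residue field is never formed. Linear algebra over it takes place in an
  \<open>L\<close>-module modulo a submodule \<open>N\<close> that absorbs the
  \<open>\<mm>\<close>-multiples of the generators; a coefficient counts as nonzero when it lies
  outside \<open>\<mm>\<close>, and is then a unit. The same lemmas thus serve ideals of
  \<open>L\<close> and the Rees algebra.

  Boundedness of the reduction numbers is indispensable because \<open>Max\<close> dominates the
  members of a finite set only. The argument for it rests on a parameter space that is the same for
  every exponent \<open>n\<close>, so that a single Noetherian ring of functions contains the minors
  for all \<open>n\<close> at once.

  The analytic spread enters through an upper bound: the hypothesis fixes the dimension of the fiber
  cone at \<open>d\<close>, while a reduction with \<open>s\<close> generators forces dimension at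
  most \<open>s\<close>. The count behind this bound is made in the Rees algebra, whose elements are
  honest polynomials over \<open>L\<close>, whereas those of the fiber cone are families of cosets
  of varying ideals.\<close>

locale local_ideal =
  fixes \<mm> :: "'a::comm_ring_1 set"
  assumes unit_outside: "x \<notin> \<mm> \<Longrightarrow> x dvd 1"
    and one_notin: "1 \<notin> \<mm>"
    and zero_in: "0 \<in> \<mm>"
    and add_in: "x \<in> \<mm> \<Longrightarrow> y \<in> \<mm> \<Longrightarrow> x + y \<in> \<mm>"
    and mult_in: "x \<in> \<mm> \<Longrightarrow> r * x \<in> \<mm>"
begin

lemma mult_in': "x \<in> \<mm> \<Longrightarrow> x * r \<in> \<mm>"
  using mult_in by (metis mult.commute)

lemma minus_in: "x \<in> \<mm> \<Longrightarrow> y \<in> \<mm> \<Longrightarrow> x - y \<in> \<mm>"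
  using add_in[of x "(- 1) * y"] mult_in[of y "- 1"] by simp

lemma sum_in: "(\<And>i. i \<in> S \<Longrightarrow> f i \<in> \<mm>) \<Longrightarrow> sum f S \<in> \<mm>"
  by (induction S rule: infinite_finite_induct) (auto simp: zero_in add_in)

lemma one_minus_not_in: "x \<in> \<mm> \<Longrightarrow> 1 - x \<notin> \<mm>"
  using add_in[of x "1 - x"] one_notin by auto

lemma inverse_outside:
  assumes "x \<notin> \<mm>"
  obtains y where "y * x = 1"
  using unit_outside[OF assms] by (metis dvdE mult.commute)

end

text \<open>Used with multiplication as \<open>scale\<close>, where subspaces are ideals and
  \<open>span\<close> is ideal generation, and with \<open>Polynomial.smult\<close> on polynomials
  over \<open>L\<close>.\<close>

locale local_module = Modules.module scale + local_ideal \<mm>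
  for scale :: "'a::comm_ring_1 \<Rightarrow> 'b::ab_group_add \<Rightarrow> 'b"  (infixr \<open>*s\<close> 75)
    and \<mm> :: "'a set"
begin

section \<open>Nakayama and elimination modulo a submodule\<close>

lemma span_insert_Un: "x \<in> span (insert y Y \<union> N) \<longleftrightarrow> (\<exists>k. x - k *s y \<in> span (Y \<union> N))"
  using span_breakdown_eq[of x y "Y \<union> N"] by simp

lemma unit_scale_mem:
  assumes "subspace V" "u \<notin> \<mm>" "u *s y \<in> V"
  shows "y \<in> V"
proof -
  obtain v where v: "v * u = 1" using inverse_outside assms(2) by blast
  have "v *s (u *s y) \<in> V" using subspace_scale[OF assms(1,3)] .
  then show ?thesis using v by (simp add: scale_scale)
qed

text \<open>Generators are discarded one at a time. The hypothesis on \<open>\<mm>\<close> puts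
  \<open>y\<close> into \<open>\<mu> *s y\<close> plus the span of the other generators and
  \<open>N\<close>; as \<open>1 - \<mu>\<close> is a unit, \<open>y\<close> itself lies in that
  span.\<close>

lemma nakayama:
  assumes "finite Y" "Y \<subseteq> I" "subspace I" "subspace N" "I \<subseteq> span (Y \<union> N)"
    and "I \<subseteq> span ({\<mu> *s x | \<mu> x. \<mu> \<in> \<mm> \<and> x \<in> I} \<union> N)"
  shows "I \<subseteq> N"
  using assms
proof (induction Y rule: finite_induct)
  case empty
  then show ?case using span_minimal[of N N] by auto
next
  case (insert y Y)
  \<comment> \<open>Modulo the remaining generators, every element of \<open>\<mm>I + N\<close> has
    a coordinate at \<open>y\<close> that lies in \<open>\<mm>\<close>.\<close>
  have *: "\<exists>\<mu>\<in>\<mm>. z - \<mu> *s y \<in> span (Y \<union> N)"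
    if "z \<in> span ({\<mu> *s x | \<mu> x. \<mu> \<in> \<mm> \<and> x \<in> I} \<union> N)" for z
    using that
  proof (induction rule: span_induct_alt)
    case base
    then show ?case using zero_in by (intro bexI[of _ 0]) (auto simp: span_zero)
  next
    case (step c x z)
    from step obtain \<nu> where \<nu>: "\<nu> \<in> \<mm>" "z - \<nu> *s y \<in> span (Y \<union> N)" by auto
    from step(1) have "\<exists>\<mu>\<in>\<mm>. x - \<mu> *s y \<in> span (Y \<union> N)"
    proof
      assume "x \<in> {\<mu> *s x | \<mu> x. \<mu> \<in> \<mm> \<and> x \<in> I}"
      then obtain \<mu> w where x: "x = \<mu> *s w" "\<mu> \<in> \<mm>" "w \<in> I" by auto
      with insert.prems obtain k where "w - k *s y \<in> span (Y \<union> N)"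
        using span_insert_Un by blast
      then have "\<mu> *s (w - k *s y) \<in> span (Y \<union> N)" by (rule span_scale)
      then have "x - (\<mu> * k) *s y \<in> span (Y \<union> N)" by (simp add: x scale_right_diff_distrib)
      then show ?thesis using x mult_in' by blast
    next
      assume "x \<in> N"
      then show ?thesis using zero_in by (intro bexI[of _ 0]) (auto intro: span_base)
    qed
    then obtain \<mu> where \<mu>: "\<mu> \<in> \<mm>" "x - \<mu> *s y \<in> span (Y \<union> N)" by auto
    have "c *s (x - \<mu> *s y) + (z - \<nu> *s y) \<in> span (Y \<union> N)"
      using \<mu> \<nu> by (intro span_add span_scale)
    then have "(c *s x + z) - (c * \<mu> + \<nu>) *s y \<in> span (Y \<union> N)"
      by (simp add: scale_right_diff_distrib scale_left_distrib algebra_simps)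
    then show ?case using \<mu> \<nu> add_in mult_in by blast
  qed
  have yI: "y \<in> I" using insert.prems by auto
  then obtain \<mu> where \<mu>: "\<mu> \<in> \<mm>" "y - \<mu> *s y \<in> span (Y \<union> N)"
    using * insert.prems by blast
  have "(1 - \<mu>) *s y \<in> span (Y \<union> N)" using \<mu> by (simp add: scale_left_diff_distrib)
  then have "y \<in> span (Y \<union> N)"
    using unit_scale_mem[OF subspace_span one_minus_not_in[OF \<mu>(1)]] by blast
  then have "insert y Y \<union> N \<subseteq> span (Y \<union> N)" by (auto intro: span_base)
  then have "I \<subseteq> span (Y \<union> N)" using insert.prems(4) span_minimal[OF _ subspace_span] by blast
  then show ?case using insert by blast
qed

text \<open>Modulo \<open>N\<close> the generators \<open>Y\<close> span a vector space over the
  residue field, and a subspace \<open>q\<close> of it is either everything or has smaller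
  dimension. The proof eliminates the coordinate at \<open>y\<close>. Keeping \<open>Y'\<close>
  inside \<open>Y \<union> q\<close> ensures that the new generators stay in any ideal containing
  both.\<close>

lemma span_or_fewer_generators:
  assumes "finite Y" "subspace q" "subspace N" "q \<subseteq> span (Y \<union> N)"
    and "\<And>\<mu> y. \<mu> \<in> \<mm> \<Longrightarrow> y \<in> Y \<Longrightarrow> \<mu> *s y \<in> N"
  shows "Y \<subseteq> span (q \<union> N) \<or>
    (\<exists>Y'. finite Y' \<and> Y' \<subseteq> Y \<union> q \<and> card Y' < card Y \<and> q \<subseteq> span (Y' \<union> N))"
  using assms
proof (induction Y arbitrary: q rule: finite_induct)
  case empty
  then show ?case by simp
next
  case (insert y Y)
  show ?case
  proof (cases "\<exists>x\<in>q. \<exists>k. k \<notin> \<mm> \<and> x - k *s y \<in> span (Y \<union> N)")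
    case False
    have "q \<subseteq> span (Y \<union> N)"
    proof
      fix x assume x: "x \<in> q"
      with insert.prems obtain k where k: "x - k *s y \<in> span (Y \<union> N)"
        using span_insert_Un by blast
      then have "k \<in> \<mm>" using False x by blast
      then have "k *s y \<in> span (Y \<union> N)" using insert.prems by (auto intro: span_base)
      with k show "x \<in> span (Y \<union> N)" using span_add by fastforce
    qed
    then show ?thesis using insert.hyps by (intro disjI2 exI[of _ Y]) auto
  next
    case True
    then obtain x u where xu: "x \<in> q" "u \<notin> \<mm>" "x - u *s y \<in> span (Y \<union> N)" by blast
    obtain v where v: "v * u = 1" using inverse_outside xu(2) by blast
    \<comment> \<open>The elements of \<open>q\<close> that can be written without \<open>y\<close>;
      subtracting a multiple of the pivot \<open>x\<close> moves any element of \<open>q\<close>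
      into this part.\<close>
    define q' where "q' = q \<inter> span (Y \<union> N)"
    have red: "z - (k * v) *s x \<in> q'" if "z \<in> q" "z - k *s y \<in> span (Y \<union> N)" for z k
    proof -
      have "(z - k *s y) - (k * v) *s (x - u *s y) \<in> span (Y \<union> N)"
        using that(2) xu(3) span_diff span_scale by blast
      moreover have "(z - k *s y) - (k * v) *s (x - u *s y) = z - (k * v) *s x"
        using v by (simp add: scale_right_diff_distrib mult.assoc)
      ultimately show ?thesis unfolding q'_def
        using that xu insert.prems by (auto intro!: subspace_diff subspace_scale)
    qed
    have "Y \<subseteq> span (q' \<union> N) \<or>
      (\<exists>Y'. finite Y' \<and> Y' \<subseteq> Y \<union> q' \<and> card Y' < card Y \<and> q' \<subseteq> span (Y' \<union> N))"
      using insert.prems by (intro insert.IH) (auto simp: q'_def intro: subspace_inter)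
    then show ?thesis
    proof
      assume Y: "Y \<subseteq> span (q' \<union> N)"
      then have Yq: "Y \<subseteq> span (q \<union> N)"
        using span_mono[of "q' \<union> N" "q \<union> N"] by (auto simp: q'_def)
      then have "span (Y \<union> N) \<subseteq> span (q \<union> N)"
        by (intro span_minimal) (auto intro: span_base)
      moreover have "x \<in> span (q \<union> N)" using xu(1) by (simp add: span_base)
      ultimately have "x - (x - u *s y) \<in> span (q \<union> N)" using xu(3) span_diff by blast
      then have "y \<in> span (q \<union> N)" using unit_scale_mem[OF subspace_span xu(2)] by simp
      with Yq show ?thesis by auto
    next
      assume "\<exists>Y'. finite Y' \<and> Y' \<subseteq> Y \<union> q' \<and> card Y' < card Y \<and> q' \<subseteq> span (Y' \<union> N)"
      then obtain Y' where Y': "finite Y'" "Y' \<subseteq> Y \<union> q'" "card Y' < card Y" "q' \<subseteq> span (Y' \<union> N)"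
        by blast
      have "q \<subseteq> span (insert x Y' \<union> N)"
      proof
        fix z assume z: "z \<in> q"
        with insert.prems obtain k where k: "z - k *s y \<in> span (Y \<union> N)"
          using span_insert_Un by blast
        then have "z - (k * v) *s x \<in> span (Y' \<union> N)" using red z Y' by blast
        then show "z \<in> span (insert x Y' \<union> N)" using span_insert_Un by blast
      qed
      moreover have "card (insert x Y') < card (insert y Y)"
        using Y' insert.hyps by (simp add: card_insert_if)
      ultimately show ?thesis using Y' xu by (intro disjI2 exI[of _ "insert x Y'"]) (auto simp: q'_def)
    qed
  qed
qed

text \<open>More vectors than generators are dependent over the residue field; a relation is
  nontrivial there when some coefficient lies outside \<open>\<mm>\<close>. Again the coordinate at
  \<open>y\<close> is eliminated with a pivot.\<close>

lemma linear_dependence: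
  assumes "finite Y" "subspace N" "finite T" "card Y < card T"
    and "\<And>t. t \<in> T \<Longrightarrow> x t \<in> span (Y \<union> N)"
    and "\<And>\<mu> y. \<mu> \<in> \<mm> \<Longrightarrow> y \<in> Y \<Longrightarrow> \<mu> *s y \<in> N"
  shows "\<exists>l. (\<exists>t\<in>T. l t \<notin> \<mm>) \<and> (\<Sum>t\<in>T. l t *s x t) \<in> N"
  using assms
proof (induction Y arbitrary: T x rule: finite_induct)
  case empty
  then obtain t where "t \<in> T" by fastforce
  moreover have "x t \<in> N" if "t \<in> T" for t
    using empty.prems(4)[OF that] span_minimal[of N N] empty.prems(1) by auto
  ultimately show ?case using one_notin subspace_sum[OF empty.prems(1), of T x]
    by (intro exI[of _ "\<lambda>_. 1"]) auto
next
  case (insert y Y)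
  have "\<exists>k. \<forall>t\<in>T. x t - k t *s y \<in> span (Y \<union> N)"
    using insert.prems(4) span_insert_Un by (intro bchoice) blast
  then obtain k where k: "\<And>t. t \<in> T \<Longrightarrow> x t - k t *s y \<in> span (Y \<union> N)" by blast
  show ?case
  proof (cases "\<forall>t\<in>T. k t \<in> \<mm>")
    case True
    have "x t \<in> span (Y \<union> N)" if "t \<in> T" for t
    proof -
      have "k t *s y \<in> span (Y \<union> N)" using True that insert.prems by (auto intro: span_base)
      with k[OF that] show ?thesis using span_add by fastforce
    qed
    then show ?thesis using insert.prems insert.hyps by (intro insert.IH) auto
  next
    case False
    then obtain s where s: "s \<in> T" "k s \<notin> \<mm>" by blast
    obtain v where v: "v * k s = 1" using inverse_outside s(2) by blast
    define x' where "x' t = x t - (k t * v) *s x s" for t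
    have "\<exists>l. (\<exists>t\<in>T - {s}. l t \<notin> \<mm>) \<and> (\<Sum>t\<in>T - {s}. l t *s x' t) \<in> N"
    proof (rule insert.IH)
      show "x' t \<in> span (Y \<union> N)" if "t \<in> T - {s}" for t
      proof -
        have "(x t - k t *s y) - (k t * v) *s (x s - k s *s y) \<in> span (Y \<union> N)"
          using k[of t] k[OF s(1)] that span_diff span_scale by blast
        moreover have "(x t - k t *s y) - (k t * v) *s (x s - k s *s y) = x' t"
          using v by (simp add: x'_def scale_right_diff_distrib mult.assoc)
        ultimately show ?thesis by simp
      qed
      show "card Y < card (T - {s})" using insert s by simp
    qed (use insert.prems in auto)
    then obtain l where l: "\<exists>t\<in>T - {s}. l t \<notin> \<mm>" "(\<Sum>t\<in>T - {s}. l t *s x' t) \<in> N" by blast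
    \<comment> \<open>The coefficient of the pivot \<open>x s\<close> collects the multiples of it
      that were subtracted in the vectors \<open>x' t\<close>.\<close>
    define l' where "l' = l(s := - (\<Sum>t\<in>T - {s}. l t * (k t * v)))"
    have "(\<Sum>t\<in>T. l' t *s x t) = l' s *s x s + (\<Sum>t\<in>T - {s}. l t *s x t)"
      using insert.prems s by (simp add: sum.remove[of T s] l'_def)
    also have "\<dots> = (\<Sum>t\<in>T - {s}. l t *s x' t)"
      by (simp add: l'_def x'_def scale_right_diff_distrib sum_subtractf scale_sum_left scale_minus_left)
    finally have "(\<Sum>t\<in>T. l' t *s x t) \<in> N" using l by simp
    moreover have "\<exists>t\<in>T. l' t \<notin> \<mm>" using l by (auto simp: l'_def)
    ultimately show ?thesis by blast
  qed
qed

end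

section \<open>Determinants over a local ring\<close>

text \<open>For \<open>scale = (*)\<close> this simp rule reverses \<open>mult.assoc\<close> and makes the simplifier loop.\<close>

declare (in Modules.module) scale_scale [simp del]

interpretation idl: Modules.module "(*) :: 'a::comm_ring_1 \<Rightarrow> 'a \<Rightarrow> 'a"
  by standard (simp_all add: algebra_simps)

sublocale local_ideal \<subseteq> idl: local_module "(*)" \<mm>
  by unfold_locales

lemma (in Modules.module) span_image_sum:
  assumes "finite T" "y \<in> span (x ` T)"
  shows "\<exists>c. y = (\<Sum>t\<in>T. scale (c t) (x t))"
  using assms(2)
proof (induction rule: span_induct_alt)
  case base
  show ?case by (intro exI[of _ "\<lambda>_. 0"]) simp
next
  case (step c z y)
  then obtain t d where "t \<in> T" "z = x t" "y = (\<Sum>t\<in>T. scale (d t) (x t))" by blast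
  then have "scale c z + y = (\<Sum>u\<in>T. scale (d u + (if u = t then c else 0)) (x u))"
    using assms(1) by (simp add: scale_left_distrib sum.distrib if_distrib[of "\<lambda>a. scale a _"] sum.delta cong: if_cong)
  then show ?case by (intro exI)
qed

lemma pick_lessThan: "i < n \<Longrightarrow> pick {..<n} i = i"
proof -
  assume i: "i < n"
  then have "{a \<in> {..<n}. a < i} = {..<i}" by auto
  then show ?thesis using pick_card_in_set[of i "{..<n}"] i by simp
qed

context local_ideal
begin

section \<open>Minors modulo the maximal ideal\<close>

lemma prod_cong_mod:
  assumes "\<And>i. i \<in> S \<Longrightarrow> f i - g i \<in> \<mm>"
  shows "prod f S - prod g S \<in> \<mm>"
  using assms
proof (induction S rule: infinite_finite_induct)
  case (insert i S)
  have "f i * (prod f S - prod g S) + (f i - g i) * prod g S \<in> \<mm>"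
    using insert by (intro add_in mult_in mult_in') auto
  then show ?case using insert by (simp add: algebra_simps)
qed (auto simp: zero_in)

lemma det_cong_mod:
  assumes "A \<in> carrier_mat n n" "B \<in> carrier_mat n n"
    and "\<And>i j. i < n \<Longrightarrow> j < n \<Longrightarrow> A $$ (i, j) - B $$ (i, j) \<in> \<mm>"
  shows "det A - det B \<in> \<mm>"
proof -
  have "det A - det B = (\<Sum>p | p permutes {0..<n}. signof p *
      ((\<Prod>i = 0..<n. A $$ (i, p i)) - (\<Prod>i = 0..<n. B $$ (i, p i))))"
    by (simp add: det_def'[OF assms(1)] det_def'[OF assms(2)] sum_subtractf right_diff_distrib)
  also have "\<dots> \<in> \<mm>"
  proof (intro sum_in mult_in prod_cong_mod)
    fix p i assume "p \<in> {p. p permutes {0..<n}}" "i \<in> {0..<n}"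
    then show "A $$ (i, p i) - B $$ (i, p i) \<in> \<mm>"
      using permutes_in_image[of p "{0..<n}" i] by (intro assms(3)) auto
  qed
  finally show ?thesis .
qed

text \<open>A selection with a repeated row has determinant 0; an injective one gives a minor up to
  the order of its rows, hence up to sign.\<close>

lemma det_selected_rows_mem:
  assumes M: "M \<in> carrier_mat s h" and minors: "minors h M \<subseteq> \<mm>"
    and f: "\<And>i. i < h \<Longrightarrow> f i < s"
  shows "det (mat\<^sub>r h h (\<lambda>i. row M (f i))) \<in> \<mm>"
proof (cases "inj_on f {0..<h}")
  case False
  then obtain i j where ij: "i < h" "j < h" "i \<noteq> j" "f i = f j" by (auto simp: inj_on_def)
  have "det (mat\<^sub>r h h (\<lambda>i. row M (f i))) = 0"
    by (rule det_identical_rows[of _ h i j]) (use ij M in auto)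
  then show ?thesis using zero_in by simp
next
  case True
  define I where "I = f ` {0..<h}"
  define S where "S = submatrix M I {..<h}"
  \<comment> \<open>The rank of row \<open>f i\<close> among the selected rows, counted from 0 as
    \<open>pick\<close> does; outside \<open>{0..<h}\<close> the identity, as
    \<open>permutes\<close> demands.\<close>
  define p where "p i = (if i < h then card {a \<in> I. a < f i} else i)" for i
  have I: "I \<subseteq> {..<s}" "card I = h" "finite I"
    using f True by (auto simp: I_def card_image)
  have dims: "{i. i < dim_row M \<and> i \<in> I} = I" "{j. j < dim_col M \<and> j \<in> {..<h}} = {..<h}"
    using M I by auto
  have S: "S \<in> carrier_mat h h" unfolding S_def submatrix_def using dims I by simp
  have p_less: "p i < h" if "i < h" for i
  proof -
    have "{a \<in> I. a < f i} \<subset> I" using that by (auto simp: I_def)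
    then show ?thesis using psubset_card_mono[OF I(3)] I that by (simp add: p_def)
  qed
  have pick: "pick I (p i) = f i" if "i < h" for i
    using that pick_card_in_set[of "f i" I] by (simp add: p_def I_def)
  have "inj_on p {0..<h}"
    using True pick by (auto simp: inj_on_def) (metis atLeastLessThan_iff le0)
  then have "bij_betw p {0..<h} {0..<h}"
    using p_less by (auto simp: bij_betw_def endo_inj_surj image_subset_iff)
  then have perm: "p permutes {0..<h}" by (rule bij_imp_permutes) (simp add: p_def)
  have "mat\<^sub>r h h (\<lambda>i. row M (f i)) = mat h h (\<lambda>(i, j). S $$ (p i, j))"
  proof (rule eq_matI)
    fix i j assume "i < dim_row (mat h h (\<lambda>(i, j). S $$ (p i, j)))"
      "j < dim_col (mat h h (\<lambda>(i, j). S $$ (p i, j)))"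
    then have ij: "i < h" "j < h" by auto
    have "S $$ (p i, j) = M $$ (f i, j)"
      unfolding S_def using ij p_less I dims by (subst submatrix_index) (auto simp: pick pick_lessThan)
    then show "mat\<^sub>r h h (\<lambda>i. row M (f i)) $$ (i, j) = mat h h (\<lambda>(i, j). S $$ (p i, j)) $$ (i, j)"
      using ij M f by simp
  qed auto
  then have "det (mat\<^sub>r h h (\<lambda>i. row M (f i))) = signof p * det S"
    using det_permute_rows[OF S perm] by simp
  moreover have "det S \<in> minors h M" unfolding minors_def S_def using I M by (intro CollectI exI) auto
  ultimately show ?thesis using minors mult_in by auto
qed

text \<open>A weak form of the Cauchy-Binet formula, which for \<open>s < h\<close> says that the determinant vanishes
  modulo \<open>\<mm>\<close>.\<close>

lemma det_mult_mem:
  assumes N: "N \<in> carrier_mat h s" and M: "M \<in> carrier_mat s h" and minors: "minors h M \<subseteq> \<mm>"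
  shows "det (N * M) \<in> \<mm>"
proof -
  \<comment> \<open>The index set of \<open>det_linear_rows_sum\<close>: one row of \<open>M\<close>
    is chosen for each row of the product.\<close>
  define F where "F = {f. (\<forall>i\<in>{0..<h}. f i \<in> {..<s}) \<and> (\<forall>i. i \<notin> {0..<h} \<longrightarrow> f i = i)}"
  let ?a = "\<lambda>i p. N $$ (i, p) \<cdot>\<^sub>v row M p"
  have "N * M = mat\<^sub>r h h (\<lambda>i. finsum_vec TYPE('a) h (?a i) {..<s})"
    using N M
    by (intro eq_matI) (auto simp: index_finsum_vec scalar_prod_def atLeast0LessThan intro!: sum.cong)
  then have "det (N * M) = (\<Sum>f\<in>F. det (mat\<^sub>r h h (\<lambda>i. ?a i (f i))))"
    unfolding F_def using M by (simp add: det_linear_rows_sum)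
  also have "\<dots> = (\<Sum>f\<in>F. (\<Prod>i = 0..<h. N $$ (i, f i)) * det (mat\<^sub>r h h (\<lambda>i. row M (f i))))"
    using M by (intro sum.cong refl det_rows_mul) auto
  also have "\<dots> \<in> \<mm>"
    using det_selected_rows_mem[OF M minors] by (intro sum_in mult_in) (auto simp: F_def)
  finally show ?thesis .
qed

text \<open>If a maximal minor is a unit, the adjugate solves the rows for the elements of
  \<open>B\<close>. Conversely, expressing \<open>B\<close> through the rows by a matrix
  \<open>N\<close> gives the relation \<open>(N * M - 1) B = 0\<close>; by independence
  \<open>N * M\<close> is the identity modulo \<open>\<mm>\<close>, so its determinant is a unit,
  which \<open>det_mult_mem\<close> forbids when all minors lie in \<open>\<mm>\<close>.\<close>

lemma minor_outside_iff:
  assumes M: "M \<in> carrier_mat s (length B)"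
    and x: "\<And>p. p < s \<Longrightarrow> x p = (\<Sum>k<length B. M $$ (p, k) * B ! k)"
    and indep: "\<And>c k. (\<Sum>k<length B. c k * B ! k) = 0 \<Longrightarrow> k < length B \<Longrightarrow> c k \<in> \<mm>"
  shows "\<not> minors (length B) M \<subseteq> \<mm> \<longleftrightarrow> set B \<subseteq> idl.span (x ` {..<s})"
proof
  define h where "h = length B"
  assume "\<not> minors (length B) M \<subseteq> \<mm>"
  then obtain I K where IK: "I \<subseteq> {..<s}" "K \<subseteq> {..<h}" "card I = h" "card K = h"
    and D: "det (submatrix M I K) \<notin> \<mm>"
    using M by (auto simp: minors_def h_def)
  have K: "K = {..<h}" using IK card_subset_eq[of "{..<h}" K] by auto
  define S where "S = submatrix M I K"
  have dims: "{i. i < dim_row M \<and> i \<in> I} = I" "{j. j < dim_col M \<and> j \<in> K} = {..<h}"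
    using M IK K by (auto simp: h_def)
  have S: "S \<in> carrier_mat h h" unfolding S_def submatrix_def using dims IK by simp
  have S_index: "S $$ (i, j) = M $$ (pick I i, j)" if "i < h" "j < h" for i j
    unfolding S_def using that IK(3) dims K by (subst submatrix_index) (simp_all add: pick_lessThan)
  have pick: "pick I i < s" if "i < h" for i
    using pick_in_set_le[of i I] IK(1,3) that by blast
  note adj = adj_mat[OF S]
  show "set B \<subseteq> idl.span (x ` {..<s})"
  proof
    fix b assume "b \<in> set B"
    then obtain k where k: "k < h" "b = B ! k" by (auto simp: in_set_conv_nth h_def)
    have "(\<Sum>i<h. adj_mat S $$ (k, i) * x (pick I i))
      = (\<Sum>i<h. \<Sum>j<h. adj_mat S $$ (k, i) * S $$ (i, j) * B ! j)"
      using pick by (simp add: x S_index sum_distrib_left mult.assoc flip: h_def)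
    also have "\<dots> = (\<Sum>j<h. (\<Sum>i<h. adj_mat S $$ (k, i) * S $$ (i, j)) * B ! j)"
      by (subst sum.swap) (simp only: sum_distrib_right)
    also have "\<dots> = (\<Sum>j<h. (adj_mat S * S) $$ (k, j) * B ! j)"
      using k S adj(1) by (intro sum.cong refl) (simp add: scalar_prod_def atLeast0LessThan)
    also have "\<dots> = (\<Sum>j<h. if j = k then det S * B ! j else 0)"
      using k by (intro sum.cong refl) (simp add: adj(3))
    also have "\<dots> = det S * b" using k by simp
    finally have "det S * b = (\<Sum>i<h. adj_mat S $$ (k, i) * x (pick I i))" by simp
    also have "\<dots> \<in> idl.span (x ` {..<s})"
      using pick by (intro idl.span_sum idl.span_scale idl.span_base) auto
    finally show "b \<in> idl.span (x ` {..<s})"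
      unfolding S_def by (rule idl.unit_scale_mem[OF idl.subspace_span D])
  qed
next
  define h where "h = length B"
  assume B: "set B \<subseteq> idl.span (x ` {..<s})"
  have "\<exists>c. B ! k = (\<Sum>p<s. c p * x p)" if "k < h" for k
    using B that by (intro idl.span_image_sum) (auto simp: h_def)
  then obtain c where c: "\<And>k. k < h \<Longrightarrow> B ! k = (\<Sum>p<s. c k p * x p)" by metis
  define N where "N = mat h s (\<lambda>(k, p). c k p)"
  have N: "N \<in> carrier_mat h s" by (simp add: N_def)
  have M': "M \<in> carrier_mat s h" using M by (simp add: h_def)
  have "det (N * M) - det (1\<^sub>m h) \<in> \<mm>"
  proof (rule det_cong_mod)
    fix k j assume k: "k < h" and j: "j < h"
    have "B ! k = (\<Sum>p<s. \<Sum>j<h. c k p * M $$ (p, j) * B ! j)"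
      by (subst c[OF k]) (simp add: x[folded h_def] sum_distrib_left mult.assoc)
    also have "\<dots> = (\<Sum>j<h. (\<Sum>p<s. c k p * M $$ (p, j)) * B ! j)"
      unfolding sum_distrib_right by (rule sum.swap)
    also have "\<dots> = (\<Sum>j<h. (N * M) $$ (k, j) * B ! j)"
      using k M' N by (intro sum.cong refl) (simp add: scalar_prod_def atLeast0LessThan N_def)
    finally have "B ! k = (\<Sum>j<h. (N * M) $$ (k, j) * B ! j)" .
    moreover have "(\<Sum>j<h. 1\<^sub>m h $$ (k, j) * B ! j) = (\<Sum>j<h. if j = k then B ! j else 0)"
      using k by (intro sum.cong) auto
    ultimately have "(\<Sum>j<h. ((N * M) $$ (k, j) - 1\<^sub>m h $$ (k, j)) * B ! j) = 0"
      using k by (simp add: left_diff_distrib sum_subtractf)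
    then show "(N * M) $$ (k, j) - 1\<^sub>m h $$ (k, j) \<in> \<mm>"
      using j unfolding h_def by (rule indep)
  qed (use N M' in auto)
  then have "det (N * M) \<notin> \<mm>"
    using minus_in[of "det (N * M)" "det (N * M) - 1"] one_notin by auto
  then show "\<not> minors (length B) M \<subseteq> \<mm>"
    using det_mult_mem[OF N M'] unfolding h_def by blast
qed

end

section \<open>Ideals of the ring underlying a type\<close>

lemma ideal_class_ring_iff: "ideal I class_ring \<longleftrightarrow> idl.subspace I"
proof
  assume "ideal I class_ring"
  then interpret ideal I class_ring .
  show "idl.subspace I"
    using zero_closed a_closed I_l_closed by (intro idl.subspaceI) auto
next
  assume I: "idl.subspace I"
  show "ideal I class_ring"
  proof (rule idealI)
    show "ring (class_ring :: 'a ring)" by (rule class_ring.ring_axioms)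
    have "a_inv class_ring x = - x" for x :: 'a
      by (simp only: class_ring_simps)
    note inv = this[unfolded a_inv_def]
    show "subgroup I (add_monoid class_ring)"
      by (rule subgroup.intro)
        (use idl.subspace_0[OF I] idl.subspace_add[OF I] idl.subspace_neg[OF I] in
          \<open>auto simp: inv[simplified]\<close>)
  qed (use idl.subspace_scale[OF I] in \<open>auto simp: mult.commute\<close>)
qed

lemma genideal_class_ring: "genideal class_ring S = idl.span S"
proof
  show "genideal class_ring S \<subseteq> idl.span S"
    unfolding genideal_def by (auto simp: ideal_class_ring_iff idl.span_superset)
  show "idl.span S \<subseteq> genideal class_ring S"
    unfolding genideal_def ideal_class_ring_iff using idl.span_minimal by blast
qed

lemma subspace_ideal_prod:
  assumes "idl.subspace I" "idl.subspace J"
  shows "idl.subspace (ideal_prod class_ring I J)"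
  using ring.ideal_prod_is_ideal[OF cring.axioms(1)[OF class_cring.is_cring]] assms
  unfolding ideal_class_ring_iff by blast

lemma ideal_prod_minimal:
  assumes "idl.subspace K" "\<And>x y. x \<in> I \<Longrightarrow> y \<in> J \<Longrightarrow> x * y \<in> K"
  shows "ideal_prod class_ring I J \<subseteq> K"
proof
  fix z assume "z \<in> ideal_prod class_ring I J"
  then show "z \<in> K"
    by induction (use assms idl.subspace_add in auto)
qed

lemma mult_mem_ideal_prod: "x \<in> I \<Longrightarrow> y \<in> J \<Longrightarrow> x * y \<in> ideal_prod class_ring I J"
  using ideal_prod.prod[of x I y J class_ring] by simp

lemma ideal_prod_mono:
  "idl.subspace I' \<Longrightarrow> idl.subspace J' \<Longrightarrow> I \<subseteq> I' \<Longrightarrow> J \<subseteq> J' \<Longrightarrow>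
    ideal_prod class_ring I J \<subseteq> ideal_prod class_ring I' J'"
  by (intro ideal_prod_minimal subspace_ideal_prod mult_mem_ideal_prod) auto

lemma ideal_prod_span:
  "ideal_prod class_ring (idl.span S) (idl.span T) = idl.span {s * t | s t. s \<in> S \<and> t \<in> T}"
    (is "?P = idl.span ?ST")
proof
  show "?P \<subseteq> idl.span ?ST"
  proof (rule ideal_prod_minimal)
    fix x y assume x: "x \<in> idl.span S" and y: "y \<in> idl.span T"
    have *: "s * y \<in> idl.span ?ST" if "s \<in> S" for s
      using y
    proof (induction rule: idl.span_induct_alt)
      case (step c t z)
      have "c * (s * t) + s * z \<in> idl.span ?ST"
        by (intro idl.span_add[OF idl.span_scale[OF idl.span_base]]) (use step that in auto)
      then show ?case by (simp add: algebra_simps)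
    qed (simp add: idl.span_zero)
    show "x * y \<in> idl.span ?ST"
      using x
    proof (induction rule: idl.span_induct_alt)
      case (step c s z)
      have "c * (s * y) + z * y \<in> idl.span ?ST"
        by (intro idl.span_add idl.span_scale[OF *]) (use step in auto)
      then show ?case by (simp add: algebra_simps)
    qed (simp add: idl.span_zero)
  qed simp
  show "idl.span ?ST \<subseteq> ?P"
    by (intro idl.span_minimal subspace_ideal_prod)
      (auto intro!: mult_mem_ideal_prod idl.span_base)
qed

lemma ideal_prod_assoc:
  assumes "idl.subspace I" "idl.subspace J" "idl.subspace K"
  shows "ideal_prod class_ring (ideal_prod class_ring I J) K
    = ideal_prod class_ring I (ideal_prod class_ring J K)"
  using ring.ideal_prod_assoc[OF cring.axioms(1)[OF class_cring.is_cring]] assms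
  unfolding ideal_class_ring_iff by blast

lemma ideal_pow_0: "ideal_pow class_ring A 0 = (UNIV :: 'a::comm_ring_1 set)"
  by (simp add: ideal_pow_def nat_pow_def ideals_set_def)

lemma ideal_pow_Suc:
  "ideal_pow class_ring A (Suc n) = ideal_prod class_ring (ideal_pow class_ring A n) A"
  by (simp add: ideal_pow_def nat_pow_def ideals_set_def)

lemma subspace_ideal_pow: "idl.subspace A \<Longrightarrow> idl.subspace (ideal_pow class_ring A n)"
  by (induction n) (auto simp: ideal_pow_0 ideal_pow_Suc intro: subspace_ideal_prod)

lemma mult_mem_ideal_pow:
  assumes "idl.subspace A"
  shows "x \<in> ideal_pow class_ring A i \<Longrightarrow> y \<in> ideal_pow class_ring A j \<Longrightarrow>
    x * y \<in> ideal_pow class_ring A (i + j)"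
proof (induction j arbitrary: y)
  case 0
  then show ?case
    using idl.subspace_scale[OF subspace_ideal_pow[OF assms], of x i y] by (simp add: mult.commute)
next
  case (Suc j)
  from Suc.prems(2) have "y \<in> ideal_prod class_ring (ideal_pow class_ring A j) A"
    by (simp add: ideal_pow_Suc)
  then show ?case
  proof induction
    case (prod u v)
    then have "(x * u) * v \<in> ideal_pow class_ring A (Suc (i + j))"
      using Suc by (auto simp: ideal_pow_Suc intro: mult_mem_ideal_prod)
    then show ?case by (simp add: mult.assoc)
  next
    case (sum s t)
    then show ?case
      using idl.subspace_add[OF subspace_ideal_pow[OF assms]] by (simp add: distrib_left)
  qed
qed

lemma ideal_gen_by_eq_span: "ideal_gen_by m a = idl.span (a ` {..<m})"
  by (simp add: ideal_gen_by_def genideal_class_ring)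

lemma ideal_pow_gen_by:
  "ideal_pow class_ring (ideal_gen_by m a) n
    = idl.span (monomial_value a ` multisets_of_size {..<m} n)"
proof (induction n)
  case 0
  have "1 * x \<in> idl.span {1}" for x :: 'a
    using idl.span_scale[of 1 "{1}" x] by (simp add: idl.span_base)
  then show ?case by (auto simp: ideal_pow_0 monomial_value_def)
next
  case (Suc n)
  have "{s * t | s t. s \<in> monomial_value a ` multisets_of_size {..<m} n \<and> t \<in> a ` {..<m}}
      = monomial_value a ` multisets_of_size {..<m} (Suc n)" (is "?L = ?R")
  proof
    show "?L \<subseteq> ?R"
    proof clarify
      fix g j assume "g \<in> multisets_of_size {..<m} n" "j < m"
      then show "monomial_value a g * a j \<in> ?R"
        by (intro image_eqI[of _ _ "add_mset j g"])
          (auto simp: monomial_value_def multisets_of_size_def mult.commute)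
    qed
    show "?R \<subseteq> ?L"
    proof clarify
      fix g assume g: "g \<in> multisets_of_size {..<m} (Suc n)"
      then obtain j g' where "g = add_mset j g'"
        unfolding multisets_of_size_def by (metis (mono_tags, lifting) mem_Collect_eq size_eq_Suc_imp_eq_union)
      with g show "\<exists>s t. monomial_value a g = s * t \<and>
          s \<in> monomial_value a ` multisets_of_size {..<m} n \<and> t \<in> a ` {..<m}"
        by (intro exI[of _ "monomial_value a g'"] exI[of _ "a j"])
          (auto simp: monomial_value_def multisets_of_size_def mult.commute)
    qed
  qed
  then show ?case
    by (simp only: ideal_pow_Suc Suc.IH) (simp only: ideal_gen_by_eq_span ideal_prod_span)
qed

lemma noetherian_ideal_finitely_generated:
  assumes "noetherian_ring (class_ring :: 'a::comm_ring_1 ring)" "idl.subspace (I :: 'a set)"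
  obtains S where "finite S" "idl.span S = I"
  using noetherian_ring.finetely_gen[OF assms(1), of I] assms(2)
  by (auto simp: ideal_class_ring_iff genideal_class_ring)

text \<open>Zorn's lemma on the proper ideals containing \<open>x\<close>. It converts uniqueness of
  the maximal ideal into invertibility of everything outside \<open>\<mm>\<close>.\<close>

lemma maximal_ideal_containing:
  fixes x :: "'a::comm_ring_1"
  assumes "\<not> x dvd 1"
  obtains N where "maximalideal N class_ring" "x \<in> N"
proof -
  define \<A> where "\<A> = {I :: 'a set. idl.subspace I \<and> x \<in> I \<and> 1 \<notin> I}"
  have "1 \<notin> idl.span {x}" using assms unfolding idl.span_singleton by (metis dvd_triv_right imageE)
  then have "idl.span {x} \<in> \<A>" by (simp add: \<A>_def idl.span_base)
  then have "\<A> \<noteq> {}" by blast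
  moreover have "\<Union>C \<in> \<A>" if "C \<noteq> {}" and C: "subset.chain \<A> C" for C
  proof -
    have CA: "C \<subseteq> \<A>" using C by (simp add: subset.chain_def)
    have "idl.subspace (\<Union>C)"
    proof (rule idl.subspaceI)
      show "0 \<in> \<Union>C" using that CA idl.subspace_0 by (fastforce simp: \<A>_def)
      show "y + z \<in> \<Union>C" if yz: "y \<in> \<Union>C" "z \<in> \<Union>C" for y z
      proof -
        from yz obtain I J where IJ: "I \<in> C" "J \<in> C" "y \<in> I" "z \<in> J" by blast
        then have "I \<subseteq> J \<or> J \<subseteq> I" using C by (auto simp: subset_chain_def)
        then show ?thesis using IJ CA idl.subspace_add unfolding \<A>_def by blast
      qed
      show "c * y \<in> \<Union>C" if "y \<in> \<Union>C" for c y
        using that CA idl.subspace_scale unfolding \<A>_def by blast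
    qed
    then show ?thesis using that CA by (auto simp: \<A>_def)
  qed
  ultimately obtain N where N: "N \<in> \<A>" "\<And>I. I \<in> \<A> \<Longrightarrow> N \<subseteq> I \<Longrightarrow> I = N"
    using subset_Zorn_nonempty[of \<A>] by blast
  have "maximalideal N class_ring"
  proof (rule maximalidealI)
    show "ideal N class_ring" using N by (simp add: \<A>_def ideal_class_ring_iff)
    show "carrier class_ring \<noteq> N" using N by (auto simp: \<A>_def)
    fix J assume J: "ideal J class_ring" "N \<subseteq> J"
    show "J = N \<or> J = carrier class_ring"
    proof (cases "1 \<in> J")
      case True
      then show ?thesis
        using idl.subspace_scale[of J 1] J by (auto simp: ideal_class_ring_iff)
    next
      case False
      then have "J \<in> \<A>" using J N by (auto simp: \<A>_def ideal_class_ring_iff)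
      then show ?thesis using N(2) J by blast
    qed
  qed
  then show thesis using that N by (auto simp: \<A>_def)
qed

lemma local_ring_imp_local_ideal:
  assumes "local_ring (class_ring :: 'a::comm_ring_1 ring) \<mm>"
  shows "local_ideal \<mm>"
proof -
  have max: "maximalideal \<mm> (class_ring :: 'a ring)"
    and unique: "\<And>N. maximalideal N (class_ring :: 'a ring) \<Longrightarrow> N = \<mm>"
    using assms by (auto simp: local_ring_def)
  interpret maximalideal \<mm> "class_ring :: 'a ring" by (rule max)
  have sub: "idl.subspace \<mm>" using is_ideal by (simp add: ideal_class_ring_iff)
  show ?thesis
  proof
    show "1 \<notin> \<mm>" using I_notcarr idl.subspace_scale[OF sub, of 1] by auto
    show "x dvd 1" if "x \<notin> \<mm>" for x
      using maximal_ideal_containing[of x] unique that by metis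
  qed (use idl.subspace_0[OF sub] idl.subspace_add[OF sub] idl.subspace_scale[OF sub] in auto)
qed

section \<open>Minimal bases and reductions\<close>

context local_ideal
begin

text \<open>A unit coefficient would let the relation be solved for its basis element, against
  irredundance. This supplies the hypothesis \<open>indep\<close> of
  \<open>minor_outside_iff\<close>.\<close>

lemma minimal_basis_relation_mem:
  assumes "minimal_basis class_ring I B" "(\<Sum>k<length B. c k * B ! k) = 0" "k < length B"
  shows "c k \<in> \<mm>"
proof (rule ccontr)
  assume "c k \<notin> \<mm>"
  have B: "distinct B" "idl.span (set B) = I" "\<forall>S. S \<subset> set B \<longrightarrow> idl.span S \<noteq> I"
    using assms(1) by (simp_all add: minimal_basis_def genideal_class_ring)
  define S where "S = set B - {B ! k}"
  have "(\<Sum>k<length B. c k * B ! k) = c k * B ! k + (\<Sum>i\<in>{..<length B} - {k}. c i * B ! i)"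
    using assms(3) by (intro sum.remove) auto
  then have "c k * B ! k = - (\<Sum>i\<in>{..<length B} - {k}. c i * B ! i)"
    unfolding assms(2) by (metis add_eq_0_iff2)
  also have "\<dots> \<in> idl.span S"
  proof (intro idl.span_neg idl.span_sum idl.span_scale idl.span_base)
    show "B ! i \<in> S" if "i \<in> {..<length B} - {k}" for i
      using that assms(3) B(1) by (auto simp: S_def nth_eq_iff_index_eq)
  qed
  finally have "B ! k \<in> idl.span S"
    by (rule idl.unit_scale_mem[OF idl.subspace_span \<open>c k \<notin> \<mm>\<close>])
  then have "set B \<subseteq> idl.span S"
    using idl.span_superset[of S] by (auto simp: S_def)
  moreover have "idl.span S \<subseteq> idl.span (set B)" by (intro idl.span_mono) (auto simp: S_def)
  ultimately have "idl.span S = idl.span (set B)" using idl.span_minimal by blast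
  moreover have "S \<subset> set B" using nth_mem[OF assms(3)] unfolding S_def by blast
  ultimately show False using B(2,3) by blast
qed

text \<open>The matrix expressing \<open>S\<close> through \<open>B\<close> has a minor of size
  \<open>length B\<close> outside \<open>\<mm>\<close>, hence at least that many rows. So
  irredundance implies minimal cardinality, and the minors in the testing ideal use all columns of
  the matrix.\<close>

lemma length_minimal_basis_le:
  assumes B: "minimal_basis class_ring I B" and S: "finite S" "idl.span S = I"
  shows "length B \<le> card S"
proof -
  obtain x where x: "bij_betw x {..<card S} S"
    using ex_bij_betw_nat_finite[OF S(1)] by (auto simp: atLeast0LessThan)
  have spanB: "idl.span (set B) = I"
    using B by (simp add: minimal_basis_def genideal_class_ring)
  have setB: "set B = (!) B ` {..<length B}" by (auto simp: set_conv_nth)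
  have "\<exists>c. x p = (\<Sum>k<length B. c k * B ! k)" if "p < card S" for p
    using x that S spanB
    by (intro idl.span_image_sum) (auto simp: bij_betw_def intro: idl.span_base simp flip: setB)
  then obtain c where c: "\<And>p. p < card S \<Longrightarrow> x p = (\<Sum>k<length B. c p k * B ! k)" by metis
  define M where "M = mat (card S) (length B) (\<lambda>(p, k). c p k)"
  have "\<not> minors (length B) M \<subseteq> \<mm> \<longleftrightarrow> set B \<subseteq> idl.span (x ` {..<card S})"
    by (rule minor_outside_iff)
      (use minimal_basis_relation_mem[OF B] c in \<open>auto simp: M_def\<close>)
  moreover have "set B \<subseteq> idl.span (x ` {..<card S})"
    using x S spanB idl.span_superset[of "set B"] by (simp add: bij_betw_def)
  ultimately obtain K where "K \<subseteq> {..<card S}" "card K = length B"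
    by (auto simp: minors_def M_def)
  then show ?thesis using card_mono[of "{..<card S}" K] by simp
qed

lemma length_minimal_basis:
  fixes B :: "'a list"
  assumes "minimal_basis class_ring I B"
  shows "length B = min_num_gens class_ring I"
  unfolding min_num_gens_def
proof (rule Least_equality[symmetric])
  show "\<exists>S. S \<subseteq> carrier class_ring \<and> finite S \<and> card S = length B \<and> genideal class_ring S = I"
    using assms by (intro exI[of _ "set B"]) (auto simp: minimal_basis_def distinct_card)
qed (use length_minimal_basis_le[OF assms] in \<open>auto simp: genideal_class_ring\<close>)

end

lemma ex_minimal_basis:
  fixes S :: "'a::comm_ring_1 set"
  assumes "finite S"
  shows "\<exists>B. minimal_basis class_ring (idl.span S) B"
proof -
  obtain T where T: "T \<subseteq> S \<and> idl.span T = idl.span S"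
    "\<And>U. U \<subseteq> S \<and> idl.span U = idl.span S \<Longrightarrow> card T \<le> card U"
    using ex_has_least_nat[of "\<lambda>T. T \<subseteq> S \<and> idl.span T = idl.span S" S card] by blast
  have "finite T" using T assms finite_subset by blast
  then obtain B where B: "set B = T" "distinct B" using finite_distinct_list by blast
  have "idl.span U \<noteq> idl.span S" if "U \<subset> T" for U
    using T(2)[of U] T(1) psubset_card_mono[OF \<open>finite T\<close> that] that by auto
  then have "minimal_basis class_ring (idl.span S) B"
    using B T(1) by (auto simp: minimal_basis_def genideal_class_ring)
  then show ?thesis ..
qed

lemma finite_multisets_of_size: "finite A \<Longrightarrow> finite (multisets_of_size A n)"
proof (induction n)
  case (Suc n)
  have "multisets_of_size A (Suc n) \<subseteq> (\<lambda>(x, X). add_mset x X) ` (A \<times> multisets_of_size A n)"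
  proof
    fix X assume X: "X \<in> multisets_of_size A (Suc n)"
    then obtain x Y where "X = add_mset x Y"
      unfolding multisets_of_size_def by (metis (mono_tags, lifting) mem_Collect_eq size_eq_Suc_imp_eq_union)
    with X show "X \<in> (\<lambda>(x, X). add_mset x X) ` (A \<times> multisets_of_size A n)"
      by (intro image_eqI[of _ _ "(x, Y)"]) (auto simp: multisets_of_size_def)
  qed
  then show ?case using Suc by (meson finite_SigmaI finite_imageI finite_subset)
qed simp

section \<open>The equation between a power of an ideal and its product with a reduction\<close>

lemma subspace_ideal_gen_by: "idl.subspace (ideal_gen_by m a)"
  by (simp add: ideal_gen_by_eq_span)

lemma ideal_prod_pow_subset:
  assumes "idl.subspace A" "Q \<subseteq> A"
  shows "ideal_prod class_ring Q (ideal_pow class_ring A n) \<subseteq> ideal_pow class_ring A (n + 1)"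
proof (rule ideal_prod_minimal)
  show "q * x \<in> ideal_pow class_ring A (n + 1)" if "q \<in> Q" "x \<in> ideal_pow class_ring A n" for q x
    using that assms(2) mult_mem_ideal_prod[of x _ q A] by (auto simp: ideal_pow_Suc mult.commute)
qed (intro subspace_ideal_pow assms)

lemma reduction_step_mono:
  assumes "idl.subspace A" "idl.subspace Q" "idl.subspace Q'" "Q' \<subseteq> Q" "Q \<subseteq> A"
    and "ideal_pow class_ring A (n + 1) = ideal_prod class_ring Q' (ideal_pow class_ring A n)"
  shows "ideal_pow class_ring A (n + 1) = ideal_prod class_ring Q (ideal_pow class_ring A n)"
proof
  show "ideal_pow class_ring A (n + 1) \<subseteq> ideal_prod class_ring Q (ideal_pow class_ring A n)"
    unfolding assms(6) using assms by (intro ideal_prod_mono subspace_ideal_pow) auto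
qed (use ideal_prod_pow_subset assms in blast)

lemma reduction_step_Suc:
  assumes "idl.subspace A" "idl.subspace Q"
    and "ideal_pow class_ring A (n + 1) = ideal_prod class_ring Q (ideal_pow class_ring A n)" "n \<le> k"
  shows "ideal_pow class_ring A (k + 1) = ideal_prod class_ring Q (ideal_pow class_ring A k)"
  using assms(4)
proof (induction k rule: dec_induct)
  case (step k)
  have "ideal_pow class_ring A (Suc k + 1) = ideal_prod class_ring (ideal_pow class_ring A (k + 1)) A"
    by (simp add: ideal_pow_Suc)
  also have "\<dots> = ideal_prod class_ring Q (ideal_prod class_ring (ideal_pow class_ring A k) A)"
    unfolding step.IH using assms by (intro ideal_prod_assoc subspace_ideal_pow)
  finally show ?case by (simp add: ideal_pow_Suc)
qed (use assms in simp)

context local_ideal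
begin

lemma subspace_max_ideal: "idl.subspace \<mm>"
  by (intro idl.subspaceI zero_in add_in mult_in)

text \<open>The products of the \<open>c i\<close> with monomials generate
  \<open>Q A\<^sup>r\<close>, and \<open>M\<close> lists their coordinates in \<open>B\<close>.
  Arbitrary \<open>c\<close> and \<open>M\<close> are allowed because the lemma serves both the
  specialized testing matrix and the matrices, one for each exponent, behind the boundedness of
  reduction numbers.\<close>

lemma reduction_step_iff_minor:
  fixes a :: "nat \<Rightarrow> 'a" and m :: nat
  defines "A \<equiv> ideal_gen_by m a"
  assumes B: "minimal_basis class_ring (ideal_pow class_ring A (r + 1)) B"
    and rs: "set rs = {..<d} \<times> multisets_of_size {..<m} r"
    and M: "M \<in> carrier_mat (length rs) (length B)"
    and rows: "\<And>p. p < length rs \<Longrightarrow>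
      c (fst (rs ! p)) * monomial_value a (snd (rs ! p)) = (\<Sum>k<length B. M $$ (p, k) * B ! k)"
    and c: "\<And>i. i < d \<Longrightarrow> c i \<in> A"
  shows "\<not> minors (length B) M \<subseteq> \<mm> \<longleftrightarrow>
    ideal_pow class_ring A (r + 1) = ideal_prod class_ring (ideal_gen_by d c) (ideal_pow class_ring A r)"
proof -
  let ?x = "\<lambda>p. c (fst (rs ! p)) * monomial_value a (snd (rs ! p))"
  have subA: "idl.subspace A" unfolding A_def by (rule subspace_ideal_gen_by)
  have spanB: "idl.span (set B) = ideal_pow class_ring A (r + 1)"
    using B by (simp add: minimal_basis_def genideal_class_ring)
  have "{s * t | s t. s \<in> c ` {..<d} \<and> t \<in> monomial_value a ` multisets_of_size {..<m} r}
      = (\<lambda>(i, g). c i * monomial_value a g) ` set rs"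
    unfolding rs by auto
  also have "\<dots> = ?x ` {..<length rs}"
    by (auto simp: set_conv_nth case_prod_beta image_iff)
  finally have prod: "ideal_prod class_ring (ideal_gen_by d c) (ideal_pow class_ring A r)
      = idl.span (?x ` {..<length rs})"
    unfolding A_def ideal_pow_gen_by by (simp add: ideal_gen_by_eq_span ideal_prod_span)
  have "ideal_gen_by d c \<subseteq> A"
    unfolding ideal_gen_by_eq_span[of d] using c subA by (intro idl.span_minimal) auto
  then have "ideal_prod class_ring (ideal_gen_by d c) (ideal_pow class_ring A r)
      \<subseteq> ideal_pow class_ring A (r + 1)"
    by (rule ideal_prod_pow_subset[OF subA])
  moreover have "set B \<subseteq> idl.span X \<longleftrightarrow> ideal_pow class_ring A (r + 1) \<subseteq> idl.span X" for X
    unfolding spanB[symmetric] using idl.span_minimal[of "set B" "idl.span X"] idl.span_superset[of "set B"] by auto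
  moreover have "\<not> minors (length B) M \<subseteq> \<mm> \<longleftrightarrow> set B \<subseteq> idl.span (?x ` {..<length rs})"
    by (rule minor_outside_iff[OF M]) (fact rows, rule minimal_basis_relation_mem[OF B])
  ultimately show ?thesis unfolding prod by blast
qed

text \<open>Replacing \<open>Q\<close> by \<open>Q'\<close> costs only terms of
  \<open>\<mm>A\<^sup>n\<^sup>+\<^sup>1\<close>, which Nakayama absorbs.\<close>

lemma reduction_step_mod_max_ideal:
  assumes A: "idl.subspace A" and fg: "\<And>n. \<exists>S. finite S \<and> idl.span S = ideal_pow class_ring A n"
    and Q': "idl.subspace Q'" "Q' \<subseteq> A" and "Q \<subseteq> idl.span (Q' \<union> ideal_prod class_ring \<mm> A)"
    and step: "ideal_pow class_ring A (n + 1) = ideal_prod class_ring Q (ideal_pow class_ring A n)"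
  shows "ideal_pow class_ring A (n + 1) = ideal_prod class_ring Q' (ideal_pow class_ring A n)"
proof
  let ?An = "ideal_pow class_ring A n" and ?An1 = "ideal_pow class_ring A (n + 1)"
  let ?N = "ideal_prod class_ring Q' ?An"
  have N: "idl.subspace ?N" by (intro subspace_ideal_prod Q' subspace_ideal_pow A)
  obtain S where S: "finite S" "idl.span S = ?An1" using fg by blast
  show "?An1 \<subseteq> ?N"
  proof (rule idl.nakayama[of S])
    show "?An1 \<subseteq> idl.span (S \<union> ?N)" using S idl.span_mono[of S "S \<union> ?N"] by auto
    let ?T = "{\<mu> * x | \<mu> x. \<mu> \<in> \<mm> \<and> x \<in> ?An1}"
    have "q * y \<in> idl.span (?T \<union> ?N)" if q: "q \<in> idl.span (Q' \<union> ideal_prod class_ring \<mm> A)" and y: "y \<in> ?An" for q y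
      using q
    proof (induction rule: idl.span_induct_alt)
      case base
      then show ?case by (simp add: idl.span_zero)
    next
      case (step c q z)
      from step(1) have "q * y \<in> idl.span (?T \<union> ?N)"
      proof
        assume "q \<in> Q'"
        then show ?thesis using y by (intro idl.span_base) (auto intro: mult_mem_ideal_prod)
      next
        assume "q \<in> ideal_prod class_ring \<mm> A"
        then show ?thesis
        proof induction
          case (prod \<mu> b)
          have "b * y \<in> ?An1"
            using prod y by (simp add: ideal_pow_Suc mult.commute[of b] mult_mem_ideal_prod)
          then show ?case using prod by (intro idl.span_base) (auto simp: mult.assoc)
        next
          case (sum s t)
          then show ?case by (simp add: distrib_right idl.span_add)
        qed
      qed
      then have "c * (q * y) + z * y \<in> idl.span (?T \<union> ?N)"
        using step by (intro idl.span_add idl.span_scale[of "q * y"])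
      then show ?case by (simp add: algebra_simps)
    qed
    then show "?An1 \<subseteq> idl.span (?T \<union> ?N)"
      unfolding step using assms(5) by (intro ideal_prod_minimal) auto
  qed (use S N A in \<open>auto intro: idl.span_base subspace_ideal_pow\<close>)
qed (use ideal_prod_pow_subset assms in blast)

text \<open>\<open>Q\<close> may need more generators than \<open>A\<close>, but not modulo
  \<open>\<mm>A\<close>, where it becomes a subspace of a space spanned by \<open>S\<close>. A
  smallest \<open>Y\<close> in \<open>A\<close> generating \<open>Q\<close> modulo
  \<open>\<mm>A\<close> must lie in \<open>Q + \<mm>A\<close>, or the exchange alternative would
  shrink it.\<close>

lemma generators_mod_max_ideal:
  assumes "idl.subspace Q" "Q \<subseteq> A" "A = idl.span S" "finite S"
  shows "\<exists>Y. finite Y \<and> Y \<subseteq> Q \<and> card Y \<le> card S \<and> Q \<subseteq> idl.span (Y \<union> ideal_prod class_ring \<mm> A)"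
proof -
  let ?N = "ideal_prod class_ring \<mm> A"
  let ?P = "\<lambda>Y. finite Y \<and> Y \<subseteq> A \<and> Q \<subseteq> idl.span (Y \<union> ?N)"
  have A: "idl.subspace A" using assms by simp
  have N: "idl.subspace ?N" by (intro subspace_ideal_prod subspace_max_ideal A)
  have "?P S" using assms idl.span_superset[of S] idl.span_mono[of S "S \<union> ?N"] by auto
  then obtain Y where Y: "?P Y" "\<And>Z. ?P Z \<Longrightarrow> card Y \<le> card Z"
    using ex_has_least_nat[of ?P S card] by blast
  have "Y \<subseteq> idl.span (Q \<union> ?N) \<or>
    (\<exists>Y'. finite Y' \<and> Y' \<subseteq> Y \<union> Q \<and> card Y' < card Y \<and> Q \<subseteq> idl.span (Y' \<union> ?N))"
    using Y assms N by (intro idl.span_or_fewer_generators) (auto intro: mult_mem_ideal_prod)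
  then have "Y \<subseteq> idl.span (Q \<union> ?N)"
    using Y assms(2) by (metis Un_least leD subset_trans)
  moreover have "idl.span Q = Q" "idl.span ?N = ?N" using assms(1) N by (simp_all only: idl.span_eq_iff)
  ultimately have Yxz: "Y \<subseteq> {x + z | x z. x \<in> Q \<and> z \<in> ?N}" by (simp only: idl.span_Un)
  then have "\<exists>x. x \<in> Q \<and> y - x \<in> ?N" if "y \<in> Y" for y
  proof -
    from Yxz that obtain x z where "y = x + z" "x \<in> Q" "z \<in> ?N" by blast
    then show ?thesis by (intro exI[of _ x]) simp
  qed
  \<comment> \<open>Moving each generator by an element of \<open>\<mm>A\<close> puts it into
    \<open>Q\<close> and keeps the span modulo \<open>\<mm>A\<close>.\<close>
  then obtain f where f: "\<And>y. y \<in> Y \<Longrightarrow> f y \<in> Q \<and> y - f y \<in> ?N" by metis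
  have "y \<in> idl.span (f ` Y \<union> ?N)" if "y \<in> Y" for y
  proof -
    have "f y + (y - f y) \<in> idl.span (f ` Y \<union> ?N)"
      using f[OF that] that by (intro idl.span_add idl.span_base) auto
    then show ?thesis by simp
  qed
  then have "Y \<union> ?N \<subseteq> idl.span (f ` Y \<union> ?N)" using idl.span_base by blast
  then have "Q \<subseteq> idl.span (f ` Y \<union> ?N)"
    using Y(1) idl.span_minimal[of "Y \<union> ?N" "idl.span (f ` Y \<union> ?N)"] by blast
  moreover have "card (f ` Y) \<le> card S"
    using card_image_le[of Y f] Y(2)[OF \<open>?P S\<close>] Y(1) by auto
  ultimately show ?thesis using f Y(1) by (intro exI[of _ "f ` Y"]) auto
qed

end

section \<open>Boundedness of reduction numbers\<close>

inductive_set lin_span :: "'b::comm_ring_1 set \<Rightarrow> 'b set \<Rightarrow> 'b set" for R S where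
  zero: "0 \<in> lin_span R S"
| step: "r \<in> R \<Longrightarrow> s \<in> S \<Longrightarrow> z \<in> lin_span R S \<Longrightarrow> r * s + z \<in> lin_span R S"

definition is_subring :: "'b::comm_ring_1 set \<Rightarrow> bool" where
  "is_subring R \<longleftrightarrow> 1 \<in> R \<and> (\<forall>x\<in>R. \<forall>y\<in>R. x - y \<in> R \<and> x * y \<in> R)"

text \<open>The finite set is drawn from \<open>X\<close> itself, since finitely many of the given
  minors are wanted rather than arbitrary generators of their ideal.\<close>

definition is_noetherian :: "'b::comm_ring_1 set \<Rightarrow> bool" where
  "is_noetherian R \<longleftrightarrow> (\<forall>X\<subseteq>R. \<exists>S\<subseteq>X. finite S \<and> X \<subseteq> lin_span R S)"

lemma is_subringD:
  assumes "is_subring R"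
  shows "1 \<in> R" "0 \<in> R" "x \<in> R \<Longrightarrow> - x \<in> R"
    "x \<in> R \<Longrightarrow> y \<in> R \<Longrightarrow> x - y \<in> R" "x \<in> R \<Longrightarrow> y \<in> R \<Longrightarrow> x + y \<in> R"
    "x \<in> R \<Longrightarrow> y \<in> R \<Longrightarrow> x * y \<in> R"
proof -
  have *: "1 \<in> R" "\<And>x y. x \<in> R \<Longrightarrow> y \<in> R \<Longrightarrow> x - y \<in> R" "\<And>x y. x \<in> R \<Longrightarrow> y \<in> R \<Longrightarrow> x * y \<in> R"
    using assms by (auto simp: is_subring_def)
  have "0 \<in> R" using *(2)[OF *(1) *(1)] by simp
  moreover have "- x \<in> R" if "x \<in> R" for x using *(2)[OF \<open>0 \<in> R\<close> that] by simp
  ultimately show "1 \<in> R" "0 \<in> R" "x \<in> R \<Longrightarrow> - x \<in> R"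
    "x \<in> R \<Longrightarrow> y \<in> R \<Longrightarrow> x - y \<in> R" "x \<in> R \<Longrightarrow> y \<in> R \<Longrightarrow> x + y \<in> R"
    "x \<in> R \<Longrightarrow> y \<in> R \<Longrightarrow> x * y \<in> R"
    using * *(2)[of x "- y"] by auto
qed

lemma is_subring_sum: "is_subring R \<Longrightarrow> (\<And>i. i \<in> S \<Longrightarrow> f i \<in> R) \<Longrightarrow> sum f S \<in> R"
  by (induction S rule: infinite_finite_induct) (auto intro: is_subringD)

lemma is_subring_prod: "is_subring R \<Longrightarrow> (\<And>i. i \<in> S \<Longrightarrow> f i \<in> R) \<Longrightarrow> prod f S \<in> R"
  by (induction S rule: infinite_finite_induct) (auto intro: is_subringD)

lemma lin_span_base: "is_subring R \<Longrightarrow> s \<in> S \<Longrightarrow> s \<in> lin_span R S"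
  using lin_span.step[of 1 R s S 0] by (auto intro: lin_span.zero is_subringD)

lemma lin_span_add: "x \<in> lin_span R S \<Longrightarrow> y \<in> lin_span R S \<Longrightarrow> x + y \<in> lin_span R S"
  by (induction x rule: lin_span.induct) (auto simp: add.assoc intro: lin_span.step)

lemma lin_span_mult:
  assumes "is_subring R" "x \<in> lin_span R S" "r \<in> R"
  shows "r * x \<in> lin_span R S"
  using assms(2)
proof induction
  case (step q s z)
  then have "(r * q) * s + r * z \<in> lin_span R S"
    using is_subringD(6)[OF assms(1,3)] by (intro lin_span.step) auto
  then show ?case by (simp add: algebra_simps)
qed (simp add: lin_span.zero)

lemma lin_span_diff:
  assumes "is_subring R" "x \<in> lin_span R S" "y \<in> lin_span R S"
  shows "x - y \<in> lin_span R S"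
  using lin_span_add[OF assms(2) lin_span_mult[OF assms(1,3), of "- 1"]] assms(1)
  by (simp add: is_subringD)

lemma lin_span_minimal:
  assumes "is_subring R" "S \<subseteq> lin_span R T"
  shows "lin_span R S \<subseteq> lin_span R T"
proof
  fix x assume "x \<in> lin_span R S"
  then show "x \<in> lin_span R T"
    by induction (use assms in \<open>auto intro: lin_span.zero lin_span_add lin_span_mult\<close>)
qed

lemma lin_span_mono: "S \<subseteq> T \<Longrightarrow> lin_span R S \<subseteq> lin_span R T"
proof
  fix x assume "S \<subseteq> T" "x \<in> lin_span R S"
  then show "x \<in> lin_span R T"
    by (induction rule: lin_span.induct[OF \<open>x \<in> lin_span R S\<close>]) (auto intro: lin_span.intros)
qed

lemma lin_span_subring: "is_subring R \<Longrightarrow> S \<subseteq> R \<Longrightarrow> lin_span R S \<subseteq> R"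
proof
  fix x assume "is_subring R" "S \<subseteq> R" "x \<in> lin_span R S"
  then show "x \<in> R"
    by (induction rule: lin_span.induct[OF \<open>x \<in> lin_span R S\<close>]) (auto intro: is_subringD)
qed

lemma lin_span_finite_support:
  assumes "x \<in> lin_span R X"
  shows "\<exists>S\<subseteq>X. finite S \<and> x \<in> lin_span R S"
  using assms
proof induction
  case zero
  show ?case by (intro exI[of _ "{}"]) (auto intro: lin_span.zero)
next
  case (step r s z)
  then obtain S where "S \<subseteq> X" "finite S" "z \<in> lin_span R S" by blast
  then show ?case using step lin_span_mono[of S "insert s S" R]
    by (intro exI[of _ "insert s S"]) (auto intro: lin_span.step)
qed

lemma lin_span_finite_supports:
  assumes "is_subring R" "finite G" "G \<subseteq> lin_span R X"
  shows "\<exists>S\<subseteq>X. finite S \<and> G \<subseteq> lin_span R S"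
  using assms(2,3)
proof (induction G rule: finite_induct)
  case (insert g G)
  then obtain S T where "S \<subseteq> X" "finite S" "G \<subseteq> lin_span R S" "T \<subseteq> X" "finite T" "g \<in> lin_span R T"
    using lin_span_finite_support[of g R X] by auto
  then show ?case using lin_span_mono[of S "S \<union> T" R] lin_span_mono[of T "S \<union> T" R]
    by (intro exI[of _ "S \<union> T"]) auto
qed auto

text \<open>Values at \<open>x\<close> of polynomials over \<open>R\<close> of degree below
  \<open>n\<close>. As \<open>x\<close> may be algebraic, an element can have several leading
  coefficients.\<close>

primrec poly_below :: "'b::comm_ring_1 set \<Rightarrow> 'b \<Rightarrow> nat \<Rightarrow> 'b set" where
  "poly_below R x 0 = {0}"
| "poly_below R x (Suc n) = {c * x ^ n + z | c z. c \<in> R \<and> z \<in> poly_below R x n}"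

lemma poly_below_SucI: "c \<in> R \<Longrightarrow> z \<in> poly_below R x n \<Longrightarrow> c * x ^ n + z \<in> poly_below R x (Suc n)"
  by auto

lemma poly_below_SucE:
  assumes "y \<in> poly_below R x (Suc n)"
  obtains c z where "y = c * x ^ n + z" "c \<in> R" "z \<in> poly_below R x n"
  using assms by auto

declare poly_below.simps(2) [simp del]

definition adjoin :: "'b::comm_ring_1 set \<Rightarrow> 'b \<Rightarrow> 'b set" where
  "adjoin R x = (\<Union>n. poly_below R x n)"

context
  fixes R :: "'b::comm_ring_1 set" and x :: 'b
  assumes R: "is_subring R"
begin

lemma poly_below_zero: "0 \<in> poly_below R x n"
proof (induction n)
  case (Suc n)
  then show ?case using poly_below_SucI[OF is_subringD(2)[OF R] Suc] by simp
qed simp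

lemma poly_below_mono: "n \<le> k \<Longrightarrow> poly_below R x n \<subseteq> poly_below R x k"
proof (induction k rule: dec_induct)
  case (step k)
  have "z \<in> poly_below R x (Suc k)" if "z \<in> poly_below R x k" for z
    using poly_below_SucI[OF is_subringD(2)[OF R] that] by simp
  then show ?case using step by blast
qed simp

lemma poly_below_diff: "y \<in> poly_below R x n \<Longrightarrow> z \<in> poly_below R x n \<Longrightarrow> y - z \<in> poly_below R x n"
proof (induction n arbitrary: y z)
  case (Suc n)
  obtain c y' where y: "y = c * x ^ n + y'" "c \<in> R" "y' \<in> poly_below R x n"
    using poly_below_SucE[OF Suc.prems(1)] by blast
  obtain d z' where z: "z = d * x ^ n + z'" "d \<in> R" "z' \<in> poly_below R x n"
    using poly_below_SucE[OF Suc.prems(2)] by blast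
  have "(c - d) * x ^ n + (y' - z') \<in> poly_below R x (Suc n)"
    using y z by (intro poly_below_SucI Suc.IH is_subringD(4)[OF R])
  then show ?case by (simp add: y z algebra_simps)
qed simp

lemma poly_below_add: "y \<in> poly_below R x n \<Longrightarrow> z \<in> poly_below R x n \<Longrightarrow> y + z \<in> poly_below R x n"
  using poly_below_diff[of y n "0 - z"] poly_below_diff[of 0 n z] poly_below_zero by simp

lemma poly_below_scale: "c \<in> R \<Longrightarrow> z \<in> poly_below R x n \<Longrightarrow> c * z \<in> poly_below R x n"
proof (induction n arbitrary: z)
  case (Suc n)
  obtain d z' where z: "z = d * x ^ n + z'" "d \<in> R" "z' \<in> poly_below R x n"
    using poly_below_SucE[OF Suc.prems(2)] by blast
  have "(c * d) * x ^ n + c * z' \<in> poly_below R x (Suc n)"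
    using z Suc.prems(1) by (intro poly_below_SucI Suc.IH is_subringD(6)[OF R])
  then show ?case by (simp add: z algebra_simps)
qed simp

lemma poly_below_shift: "z \<in> poly_below R x n \<Longrightarrow> x ^ k * z \<in> poly_below R x (n + k)"
proof (induction n arbitrary: z)
  case (Suc n)
  obtain d z' where z: "z = d * x ^ n + z'" "d \<in> R" "z' \<in> poly_below R x n"
    using poly_below_SucE[OF Suc.prems] by blast
  have "d * x ^ (n + k) + x ^ k * z' \<in> poly_below R x (Suc (n + k))"
    using z by (intro poly_below_SucI Suc.IH)
  then show ?case by (simp add: z algebra_simps power_add)
qed (simp add: poly_below_zero)

lemma poly_below_monom: "c \<in> R \<Longrightarrow> c * x ^ n \<in> poly_below R x (Suc n)"
  using poly_below_SucI[OF _ poly_below_zero] by fastforce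

lemma poly_below_subset_adjoin: "poly_below R x n \<subseteq> adjoin R x"
  by (auto simp: adjoin_def)

lemma poly_below_mult_mem_adjoin:
  "y \<in> poly_below R x n \<Longrightarrow> z \<in> poly_below R x k \<Longrightarrow> y * z \<in> poly_below R x (n + k)"
proof (induction n arbitrary: y)
  case 0
  then show ?case by (simp add: poly_below_zero)
next
  case (Suc n)
  obtain c y' where *: "y = c * x ^ n + y'" "c \<in> R" "y' \<in> poly_below R x n"
    using poly_below_SucE[OF Suc.prems(1)] by blast
  have "c * (x ^ n * z) \<in> poly_below R x (k + n)"
    using * Suc by (intro poly_below_scale poly_below_shift)
  moreover have "y' * z \<in> poly_below R x (n + k)" using * Suc by auto
  ultimately have "c * (x ^ n * z) + y' * z \<in> poly_below R x (n + k)"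
    by (intro poly_below_add) (auto simp: add.commute)
  then show ?case using poly_below_mono[of "n + k" "Suc n + k"] * by (auto simp: algebra_simps)
qed

lemma is_subring_adjoin: "is_subring (adjoin R x)"
  unfolding is_subring_def
proof (intro conjI ballI)
  show "1 \<in> adjoin R x"
    using poly_below_monom[of 1 0] is_subringD(1)[OF R] poly_below_subset_adjoin[of 1] by auto
  fix y z assume "y \<in> adjoin R x" "z \<in> adjoin R x"
  then obtain n k where nk: "y \<in> poly_below R x n" "z \<in> poly_below R x k" by (auto simp: adjoin_def)
  then show "y * z \<in> adjoin R x" using poly_below_mult_mem_adjoin poly_below_subset_adjoin by blast
  have "y \<in> poly_below R x (max n k)" "z \<in> poly_below R x (max n k)"
    using nk poly_below_mono[of n "max n k"] poly_below_mono[of k "max n k"] by auto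
  then show "y - z \<in> adjoin R x" using poly_below_diff poly_below_subset_adjoin by blast
qed

lemma subset_adjoin: "R \<subseteq> adjoin R x"
  using poly_below_monom[of _ 0] poly_below_subset_adjoin[of 1] by auto

lemma mem_adjoin: "x \<in> adjoin R x"
  using poly_below_monom[OF is_subringD(1)[OF R], of 1] poly_below_subset_adjoin[of 2]
  by (auto simp: numeral_2_eq_2)

text \<open>Hilbert's basis theorem. The ideal \<open>I\<close> generated by \<open>X\<close> is generated by finitely many
  elements whose leading coefficients generate the ideals \<open>L k\<close> of leading coefficients in every
  degree \<open>k\<close>.\<close>

lemma is_noetherian_adjoin:
  assumes noeth: "is_noetherian R"
  shows "is_noetherian (adjoin R x)"
  unfolding is_noetherian_def
proof (intro allI impI)
  fix X assume X: "X \<subseteq> adjoin R x"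
  note adj = is_subringD[OF is_subring_adjoin]
  define I where "I = lin_span (adjoin R x) X"
  define L where "L k = {c \<in> R. \<exists>z\<in>poly_below R x k. c * x ^ k + z \<in> I}" for k
  have I_mult: "r * z \<in> I" if "z \<in> I" "r \<in> adjoin R x" for r z
    unfolding I_def using that by (intro lin_span_mult is_subring_adjoin) (auto simp: I_def)
  have L_noeth: "\<exists>S\<subseteq>Y. finite S \<and> Y \<subseteq> lin_span R S" if "Y \<subseteq> (\<Union>k. L k)" for Y
    using noeth that unfolding is_noetherian_def by (auto simp: L_def)
  have x_pow: "x ^ k \<in> adjoin R x" for k
    using is_subring_prod[OF is_subring_adjoin, of "{..<k}" "\<lambda>_. x"] mem_adjoin by simp
  obtain U where U: "U \<subseteq> (\<Union>k. L k)" "finite U" "(\<Union>k. L k) \<subseteq> lin_span R U"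
    using L_noeth[of "\<Union>k. L k"] by blast
  then have "\<forall>s\<in>U. \<exists>k. s \<in> L k" by blast
  then obtain deg where deg: "\<And>s. s \<in> U \<Longrightarrow> s \<in> L (deg s)" by metis
  \<comment> \<open>From degree \<open>K\<close> on, multiplying the elements chosen for
    \<open>U\<close> by powers of \<open>x\<close> yields all leading coefficients; each of the
    finitely many degrees below \<open>K\<close> gets its own generators \<open>S k\<close>.\<close>
  define K where "K = Max (insert 0 (deg ` U))"
  have K: "deg s \<le> K" if "s \<in> U" for s using that U(2) by (simp add: K_def)
  have "\<forall>k. \<exists>S\<subseteq>L k. finite S \<and> L k \<subseteq> lin_span R S"
    using L_noeth[of "L _"] by blast
  then obtain S where S: "\<And>k. S k \<subseteq> L k" "\<And>k. finite (S k)" "\<And>k. L k \<subseteq> lin_span R (S k)"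
    by metis
  have "\<forall>k s. \<exists>z. s \<in> L k \<longrightarrow> z \<in> poly_below R x k \<and> s * x ^ k + z \<in> I"
    by (auto simp: L_def)
  then obtain w where w: "\<And>k s. s \<in> L k \<Longrightarrow> w k s \<in> poly_below R x k \<and> s * x ^ k + w k s \<in> I"
    by metis
  define lead where "lead k s = s * x ^ k + w k s" for k s
  define G where "G = (\<lambda>s. lead (deg s) s) ` U \<union> (\<Union>k<K. lead k ` S k)"
  have G: "finite G" "G \<subseteq> I"
    using U S deg w S(1)[THEN subsetD] by (auto simp: G_def lead_def)
  let ?J = "lin_span (adjoin R x) G"
  have J: "?J \<subseteq> I"
    unfolding I_def using G by (intro lin_span_minimal is_subring_adjoin) (auto simp: I_def)
  \<comment> \<open>Having a lift to \<open>?J\<close> with prescribed leading term is preserved by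
    \<open>R\<close>-linear combinations, so it has to be checked on generators only.\<close>
  have lift: "\<exists>y\<in>?J. y - c * x ^ k \<in> poly_below R x k"
    if c: "c \<in> lin_span R T" and T: "\<And>s. s \<in> T \<Longrightarrow> \<exists>y\<in>?J. y - s * x ^ k \<in> poly_below R x k" for c k T
    using c
  proof induction
    case zero
    then show ?case using lin_span.zero poly_below_zero by (intro bexI[of _ 0]) auto
  next
    case (step r s c)
    then obtain y1 y2 where y: "y1 \<in> ?J" "y1 - s * x ^ k \<in> poly_below R x k"
      "y2 \<in> ?J" "y2 - c * x ^ k \<in> poly_below R x k" using T by meson
    have "r * (y1 - s * x ^ k) + (y2 - c * x ^ k) \<in> poly_below R x k"
      using y step by (intro poly_below_add poly_below_scale)
    then have "(r * y1 + y2) - (r * s + c) * x ^ k \<in> poly_below R x k" by (simp add: algebra_simps)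
    moreover have "r * y1 + y2 \<in> ?J"
      using y step subset_adjoin by (intro lin_span_add lin_span_mult is_subring_adjoin) auto
    ultimately show ?case by blast
  qed
  have lead_lift: "\<exists>y\<in>?J. y - c * x ^ k \<in> poly_below R x k" if "c \<in> L k" for c k
  proof (cases "k < K")
    case True
    show ?thesis
    proof (rule lift)
      show "c \<in> lin_span R (S k)" using S(3) that by blast
      fix s assume "s \<in> S k"
      then have "lead k s \<in> ?J" using True by (intro lin_span_base is_subring_adjoin) (auto simp: G_def)
      then show "\<exists>y\<in>?J. y - s * x ^ k \<in> poly_below R x k"
        using w[of s k] S(1)[of k] \<open>s \<in> S k\<close> by (intro bexI[of _ "lead k s"]) (auto simp: lead_def)
    qed
  next
    case False
    show ?thesis
    proof (rule lift)
      show "c \<in> lin_span R U" using U(3) that by blast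
      fix s assume s: "s \<in> U"
      let ?e = "k - deg s"
      have k: "k = deg s + ?e" using K[OF s] False by simp
      have "x ^ ?e * lead (deg s) s \<in> ?J"
        using s x_pow by (intro lin_span_mult lin_span_base is_subring_adjoin) (auto simp: G_def)
      moreover have "x ^ ?e * w (deg s) s \<in> poly_below R x (deg s + ?e)"
        using w[OF deg[OF s]] by (intro poly_below_shift) auto
      moreover have "x ^ ?e * lead (deg s) s - s * x ^ (deg s + ?e) = x ^ ?e * w (deg s) s"
        by (simp add: lead_def power_add algebra_simps)
      ultimately show "\<exists>y\<in>?J. y - s * x ^ k \<in> poly_below R x k" using k by metis
    qed
  qed
  have "y \<in> ?J" if "y \<in> I" "y \<in> poly_below R x k" for y k
    using that
  proof (induction k arbitrary: y)
    case 0
    then show ?case by (simp add: lin_span.zero)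
  next
    case (Suc k)
    obtain c z where y: "y = c * x ^ k + z" "c \<in> R" "z \<in> poly_below R x k"
      using poly_below_SucE[OF Suc.prems(2)] by blast
    then have "c \<in> L k" using Suc.prems(1) by (auto simp: L_def)
    then obtain v where v: "v \<in> ?J" "v - c * x ^ k \<in> poly_below R x k" using lead_lift by blast
    have "z - (v - c * x ^ k) \<in> poly_below R x k" by (rule poly_below_diff[OF y(3) v(2)])
    then have "y - v \<in> poly_below R x k" by (simp add: y algebra_simps)
    moreover have "y - v \<in> I"
      unfolding I_def using Suc.prems v J
      by (intro lin_span_diff is_subring_adjoin) (auto simp: I_def)
    ultimately have "(y - v) + v \<in> ?J" using v Suc.IH by (intro lin_span_add) auto
    then show ?case by simp
  qed
  moreover have "I \<subseteq> adjoin R x"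
    unfolding I_def by (intro lin_span_subring is_subring_adjoin X)
  ultimately have "I \<subseteq> ?J" by (auto simp: adjoin_def)
  \<comment> \<open>The elements of \<open>G\<close> lie in \<open>I\<close> but not necessarily in
    \<open>X\<close>; finitely many elements of \<open>X\<close> generate them.\<close>
  obtain T where T: "T \<subseteq> X" "finite T" "G \<subseteq> lin_span (adjoin R x) T"
    using lin_span_finite_supports[OF is_subring_adjoin G(1), of X] G(2) by (auto simp: I_def)
  then have "?J \<subseteq> lin_span (adjoin R x) T" by (intro lin_span_minimal is_subring_adjoin)
  moreover have "X \<subseteq> I" unfolding I_def using lin_span_base[OF is_subring_adjoin] by blast
  ultimately show "\<exists>T\<subseteq>X. finite T \<and> X \<subseteq> lin_span (adjoin R x) T"
    using T \<open>I \<subseteq> ?J\<close> by blast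
qed

end

lemma span_eq_lin_span: "idl.span S = lin_span UNIV S"
proof
  show "idl.span S \<subseteq> lin_span UNIV S"
  proof
    fix x assume "x \<in> idl.span S"
    then show "x \<in> lin_span UNIV S"
      by (induction rule: idl.span_induct_alt) (auto intro: lin_span.intros)
  qed
  show "lin_span UNIV S \<subseteq> idl.span S"
  proof
    fix x assume "x \<in> lin_span UNIV S"
    then show "x \<in> idl.span S"
      by induction (auto intro: idl.span_zero idl.span_add idl.span_scale[OF idl.span_base])
  qed
qed

section \<open>Polynomial functions of the parameters\<close>

lemma is_noetherian_constants:
  assumes "noetherian_ring (class_ring :: 'a::comm_ring_1 ring)"
  shows "is_noetherian (range (\<lambda>(r :: 'a) (_ :: 'p). r))"
  unfolding is_noetherian_def
proof (intro allI impI)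
  let ?c = "\<lambda>(r :: 'a) (_ :: 'p). r"
  fix X assume X: "X \<subseteq> range ?c"
  define Y where "Y = {r. ?c r \<in> X}"
  obtain S where S: "finite S" "idl.span S = idl.span Y"
    using noetherian_ideal_finitely_generated[OF assms, of "idl.span Y"] by auto
  then obtain U where U: "U \<subseteq> Y" "finite U" "S \<subseteq> idl.span U"
    using lin_span_finite_supports[of UNIV S Y] idl.span_base[of _ S]
    by (auto simp: span_eq_lin_span is_subring_def)
  then have "idl.span Y \<subseteq> idl.span U" using S(2) idl.span_minimal[of S "idl.span U"] by simp
  have "?c r \<in> lin_span (range ?c) (?c ` U)" if "r \<in> idl.span U" for r
    using that
  proof (induction rule: idl.span_induct_alt)
    case base
    then show ?case using lin_span.zero[of "range ?c" "?c ` U"] by (simp add: zero_fun_def)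
  next
    case (step c s z)
    then have "?c c * ?c s + ?c z \<in> lin_span (range ?c) (?c ` U)" by (intro lin_span.step) auto
    then show ?case by (simp add: plus_fun_def times_fun_def)
  qed
  moreover have "X \<subseteq> ?c ` idl.span Y"
    using X idl.span_base[of _ Y] by (force simp: Y_def)
  ultimately have "X \<subseteq> lin_span (range ?c) (?c ` U)" using \<open>idl.span Y \<subseteq> idl.span U\<close> by blast
  then show "\<exists>S\<subseteq>X. finite S \<and> X \<subseteq> lin_span (range ?c) S"
    using U by (intro exI[of _ "?c ` U"]) (auto simp: Y_def)
qed

text \<open>The basis theorem is applied once for each function in \<open>V\<close>, starting from
  the constants. Representing the ring by functions makes specialization mere application to a
  point.\<close>

lemma noetherian_function_ring:
  fixes V :: "('p \<Rightarrow> 'a::comm_ring_1) set"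
  assumes "noetherian_ring (class_ring :: 'a ring)" "finite V"
  shows "\<exists>R. is_subring R \<and> is_noetherian R \<and> range (\<lambda>r _. r) \<subseteq> R \<and> V \<subseteq> R"
  using assms(2)
proof (induction V rule: finite_induct)
  case empty
  have "is_subring (range (\<lambda>(r :: 'a) (_ :: 'p). r))"
    by (auto simp: is_subring_def fun_diff_def times_fun_def one_fun_def)
  then show ?case using is_noetherian_constants[OF assms(1)] by blast
next
  case (insert v V)
  then obtain R where "is_subring R" "is_noetherian R" "range (\<lambda>r _. r) \<subseteq> R" "V \<subseteq> R" by blast
  then show ?case using subset_adjoin[of R v] mem_adjoin[of R v] is_subring_adjoin[of R v]
      is_noetherian_adjoin[of R v] by (intro exI[of _ "adjoin R v"]) auto
qed

lemma sum_fun_apply: "sum f S x = (\<Sum>i\<in>S. f i x)" for f :: "'i \<Rightarrow> 'p \<Rightarrow> 'a::comm_ring_1"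
  by (induction S rule: infinite_finite_induct) auto

lemma prod_fun_apply: "prod f S x = (\<Prod>i\<in>S. f i x)" for f :: "'i \<Rightarrow> 'p \<Rightarrow> 'a::comm_ring_1"
  by (induction S rule: infinite_finite_induct) auto

text \<open>By the Leibniz formula the minor for a fixed choice of rows and columns is, as a
  function of the parameter, an element of \<open>R\<close>; \<open>\<Phi>\<close> collects these
  functions.\<close>

lemma minors_specialize:
  assumes "is_subring R" "range (\<lambda>r _. r) \<subseteq> R"
    and "\<And>p k. p < s \<Longrightarrow> k < h \<Longrightarrow> (\<lambda>\<alpha>. M \<alpha> $$ (p, k)) \<in> R"
    and "\<And>\<alpha>. M \<alpha> \<in> carrier_mat s h"
  shows "\<exists>\<Phi>\<subseteq>R. \<forall>\<alpha>. minors h (M \<alpha>) = (\<lambda>\<phi>. \<phi> \<alpha>) ` \<Phi>"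
proof -
  define \<Phi> where "\<Phi> = {\<lambda>\<alpha>. det (submatrix (M \<alpha>) I K) | I K.
    I \<subseteq> {..<s} \<and> K \<subseteq> {..<h} \<and> card I = h \<and> card K = h}"
  have "\<Phi> \<subseteq> R"
  proof
    fix \<phi> assume "\<phi> \<in> \<Phi>"
    then obtain I K where IK: "I \<subseteq> {..<s}" "K \<subseteq> {..<h}" "card I = h" "card K = h"
      and \<phi>: "\<phi> = (\<lambda>\<alpha>. det (submatrix (M \<alpha>) I K))" by (auto simp: \<Phi>_def)
    have dims: "{i. i < dim_row (M \<alpha>) \<and> i \<in> I} = I" "{j. j < dim_col (M \<alpha>) \<and> j \<in> K} = K" for \<alpha>
      using IK assms(4)[of \<alpha>] by auto
    have S: "submatrix (M \<alpha>) I K \<in> carrier_mat h h" for \<alpha>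
      unfolding submatrix_def dims using IK by simp
    have pick: "pick I i < s" "pick K i < h" if "i < h" for i
      using pick_in_set_le[of i I] pick_in_set_le[of i K] that IK by auto
    have "\<phi> = (\<Sum>p | p permutes {0..<h}. (\<lambda>_. signof p) *
        (\<Prod>i = 0..<h. (\<lambda>\<alpha>. M \<alpha> $$ (pick I i, pick K (p i)))))"
    proof
      fix \<alpha>
      have "\<phi> \<alpha> = (\<Sum>p | p permutes {0..<h}. signof p * (\<Prod>i = 0..<h. submatrix (M \<alpha>) I K $$ (i, p i)))"
        by (simp add: \<phi> det_def'[OF S])
      also have "\<dots> = (\<Sum>p | p permutes {0..<h}. signof p * (\<Prod>i = 0..<h. M \<alpha> $$ (pick I i, pick K (p i))))"
      proof (intro sum.cong prod.cong refl arg_cong2[where f = "(*)"])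
        fix p i assume "p \<in> {p. p permutes {0..<h}}" "i \<in> {0..<h}"
        then have "i < h" "p i < h" using permutes_in_image[of p "{0..<h}" i] by auto
        then show "submatrix (M \<alpha>) I K $$ (i, p i) = M \<alpha> $$ (pick I i, pick K (p i))"
          using dims IK by (intro submatrix_index) simp_all
      qed
      also have "\<dots> = (\<Sum>p | p permutes {0..<h}. (\<lambda>_. signof p) *
        (\<Prod>i = 0..<h. (\<lambda>\<alpha>. M \<alpha> $$ (pick I i, pick K (p i))))) \<alpha>"
        by (simp add: sum_fun_apply prod_fun_apply times_fun_def)
      finally show "\<phi> \<alpha> = \<dots>" .
    qed
    also have "\<dots> \<in> R"
    proof (intro is_subring_sum is_subring_prod is_subringD(6) assms(1))
      fix p i assume "p \<in> {p. p permutes {0..<h}}" "i \<in> {0..<h}"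
      then have "i < h" "p i < h" using permutes_in_image[of p "{0..<h}" i] by auto
      then show "(\<lambda>\<alpha>. M \<alpha> $$ (pick I i, pick K (p i))) \<in> R" using assms(3) pick by blast
    qed (use assms(2) in auto)
    finally show "\<phi> \<in> R" .
  qed
  moreover have "minors h (M \<alpha>) = (\<lambda>\<phi>. \<phi> \<alpha>) ` \<Phi>" for \<alpha>
    using assms(4)[of \<alpha>] by (auto simp: minors_def \<Phi>_def image_iff) blast+
  ultimately show ?thesis by blast
qed

context local_ideal
begin

text \<open>Used in contrapositive form: if a function in the span has a unit value at
  \<open>\<alpha>\<close>, so has one of the generating functions.\<close>

lemma lin_span_eval_mem:
  assumes "\<phi> \<in> lin_span R S" "\<And>\<psi>. \<psi> \<in> S \<Longrightarrow> \<psi> \<alpha> \<in> \<mm>"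
  shows "\<phi> \<alpha> \<in> \<mm>"
  using assms(1)
proof induction
  case zero
  then show ?case by (simp add: zero_in)
next
  case (step r s z)
  then show ?case using assms(2) by (simp add: times_fun_def plus_fun_def add_in mult_in)
qed

text \<open>The ideals with \<open>A\<^sup>n\<^sup>+\<^sup>1 = Q A\<^sup>n\<close> that are generated by \<open>m\<close> elements of \<open>A\<close>
  correspond to the parameters at which one of the polynomials in \<open>\<Phi> n\<close> is a unit. As the ring of
  these polynomials is Noetherian, finitely many \<open>n\<close> suffice.\<close>

theorem reduction_numbers_bounded:
  fixes a :: "nat \<Rightarrow> 'a" and m :: nat
  defines "A \<equiv> ideal_gen_by m a"
  assumes noeth: "noetherian_ring (class_ring :: 'a ring)"
  shows "\<exists>N. \<forall>Q. reduction class_ring Q A \<longrightarrow>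
    (\<exists>n\<le>N. ideal_pow class_ring A (n + 1) = ideal_prod class_ring Q (ideal_pow class_ring A n))"
proof -
  have A: "idl.subspace A" unfolding A_def by (rule subspace_ideal_gen_by)
  have A_span: "A = idl.span (a ` {..<m})" unfolding A_def by (rule ideal_gen_by_eq_span)
  have fg: "\<exists>S. finite S \<and> idl.span S = ideal_pow class_ring A n" for n
    using noetherian_ideal_finitely_generated[OF noeth subspace_ideal_pow[OF A]] by metis
  have "\<exists>B. minimal_basis class_ring (ideal_pow class_ring A (n + 1)) B" for n
    using fg[of "n + 1"] ex_minimal_basis by metis
  then obtain B where B: "\<And>n. minimal_basis class_ring (ideal_pow class_ring A (n + 1)) (B n)"
    by metis
  \<comment> \<open>The first index runs below \<open>m\<close>, not \<open>d\<close>: up to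
    \<open>\<mm>A\<close>, every reduction is to be met by a parameter.\<close>
  have "\<exists>rs. set rs = {..<m} \<times> multisets_of_size {..<m} n" for n
    by (intro finite_list finite_cartesian_product finite_multisets_of_size) auto
  then obtain rs where rs: "\<And>n. set (rs n) = {..<m} \<times> multisets_of_size {..<m} n" by metis
  have "\<exists>c. a j * monomial_value a g = (\<Sum>k<length (B n). c k * B n ! k)"
    if "j < m" "g \<in> multisets_of_size {..<m} n" for n j g
  proof -
    have "monomial_value a g \<in> ideal_pow class_ring A n"
      unfolding A_def ideal_pow_gen_by using that by (intro idl.span_base) auto
    moreover have "a j \<in> A" unfolding A_span using that by (intro idl.span_base) auto
    ultimately have "a j * monomial_value a g \<in> ideal_pow class_ring A (n + 1)"
      using ideal_prod_pow_subset[OF A, of A n] mult_mem_ideal_prod by blast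
    also have "ideal_pow class_ring A (n + 1) = idl.span ((!) (B n) ` {..<length (B n)})"
      using B[of n] nth_image[of "length (B n)" "B n"]
      by (simp add: minimal_basis_def genideal_class_ring atLeast0LessThan)
    finally show ?thesis by (intro idl.span_image_sum) auto
  qed
  note coeffs = this
  \<comment> \<open>The coordinates are fixed independently of \<open>\<alpha>\<close>, which makes
    the entries of \<open>M n \<alpha>\<close> linear forms in the parameters.\<close>
  define l where "l n j g = (SOME c. a j * monomial_value a g = (\<Sum>k<length (B n). c k * B n ! k))"
    for n j g
  have l: "a j * monomial_value a g = (\<Sum>k<length (B n). l n j g k * B n ! k)"
    if "j < m" "g \<in> multisets_of_size {..<m} n" for n j g
    unfolding l_def by (rule someI_ex[OF coeffs[OF that]])
  define M where "M n \<alpha> = mat (length (rs n)) (length (B n))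
    (\<lambda>(p, k). \<Sum>j<m. \<alpha> (fst (rs n ! p)) j * l n j (snd (rs n ! p)) k)" for n and \<alpha> :: "nat \<Rightarrow> nat \<Rightarrow> 'a"
  define V where "V = (\<lambda>(i, j) (\<alpha> :: nat \<Rightarrow> nat \<Rightarrow> 'a). \<alpha> i j) ` ({..<m} \<times> {..<m})"
  obtain R where R: "is_subring R" "is_noetherian R" "range (\<lambda>r _. r) \<subseteq> R" "V \<subseteq> R"
    using noetherian_function_ring[OF noeth, of V] by (auto simp: V_def)
  have "\<exists>\<Phi>\<subseteq>R. \<forall>\<alpha>. minors (length (B n)) (M n \<alpha>) = (\<lambda>\<phi>. \<phi> \<alpha>) ` \<Phi>" for n
  proof (rule minors_specialize[OF R(1,3)])
    show "M n \<alpha> \<in> carrier_mat (length (rs n)) (length (B n))" for \<alpha> by (simp add: M_def)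
    fix p k assume pk: "p < length (rs n)" "k < length (B n)"
    have p: "fst (rs n ! p) < m" using nth_mem[OF pk(1)] unfolding rs by (simp add: mem_Times_iff)
    have "(\<lambda>\<alpha>. M n \<alpha> $$ (p, k)) =
      (\<Sum>j<m. (\<lambda>\<alpha>. \<alpha> (fst (rs n ! p)) j) * (\<lambda>_. l n j (snd (rs n ! p)) k))"
      using pk by (simp add: fun_eq_iff M_def sum_fun_apply times_fun_def)
    also have "\<dots> \<in> R"
    proof (intro is_subring_sum is_subringD(6) R(1))
      show "(\<lambda>\<alpha>. \<alpha> (fst (rs n ! p)) j) \<in> R" if "j \<in> {..<m}" for j
        using R(4) p that by (auto simp: V_def)
    qed (use R(3) in auto)
    finally show "(\<lambda>\<alpha>. M n \<alpha> $$ (p, k)) \<in> R" .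
  qed
  then obtain \<Phi> where \<Phi>: "\<And>n. \<Phi> n \<subseteq> R" "\<And>n \<alpha>. minors (length (B n)) (M n \<alpha>) = (\<lambda>\<phi>. \<phi> \<alpha>) ` \<Phi> n"
    by metis
  obtain S where S: "S \<subseteq> (\<Union>n. \<Phi> n)" "finite S" "(\<Union>n. \<Phi> n) \<subseteq> lin_span R S"
    using R(2) \<Phi>(1) unfolding is_noetherian_def by (metis UN_least)
  then have "\<forall>\<psi>\<in>S. \<exists>n. \<psi> \<in> \<Phi> n" by blast
  then obtain deg where deg: "\<And>\<psi>. \<psi> \<in> S \<Longrightarrow> \<psi> \<in> \<Phi> (deg \<psi>)" by metis
  \<comment> \<open>All functions of \<open>S\<close> occur up to index \<open>N\<close>, so a
    parameter at which some \<open>\<Phi> n\<close> has a unit value has one already for an index at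
    most \<open>N\<close>.\<close>
  define N where "N = Max (insert 0 (deg ` S))"
  have N: "deg \<psi> \<le> N" if "\<psi> \<in> S" for \<psi> using that S(2) by (simp add: N_def)
  have step_iff: "(\<exists>\<phi>\<in>\<Phi> n. \<phi> \<alpha> \<notin> \<mm>) \<longleftrightarrow> ideal_pow class_ring A (n + 1)
      = ideal_prod class_ring (ideal_gen_by m (\<lambda>i. \<Sum>j<m. \<alpha> i j * a j)) (ideal_pow class_ring A n)"
    for n \<alpha>
  proof -
    let ?c = "\<lambda>i. \<Sum>j<m. \<alpha> i j * a j"
    have "\<not> minors (length (B n)) (M n \<alpha>) \<subseteq> \<mm> \<longleftrightarrow> ideal_pow class_ring A (n + 1)
      = ideal_prod class_ring (ideal_gen_by m ?c) (ideal_pow class_ring A n)"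
      unfolding A_def
    proof (rule reduction_step_iff_minor[OF _ rs])
      show "minimal_basis class_ring (ideal_pow class_ring (ideal_gen_by m a) (n + 1)) (B n)"
        using B unfolding A_def .
      show "M n \<alpha> \<in> carrier_mat (length (rs n)) (length (B n))" by (simp add: M_def)
      show "?c i \<in> ideal_gen_by m a" for i
        unfolding ideal_gen_by_eq_span by (intro idl.span_sum idl.span_scale idl.span_base) auto
      fix p assume p: "p < length (rs n)"
      obtain i g where ig: "rs n ! p = (i, g)" by force
      then have g: "g \<in> multisets_of_size {..<m} n" using nth_mem[OF p] unfolding rs by simp
      have "?c i * monomial_value a g = (\<Sum>j<m. \<alpha> i j * (a j * monomial_value a g))"
        by (simp add: sum_distrib_right mult.assoc)
      also have "\<dots> = (\<Sum>j<m. \<Sum>k<length (B n). \<alpha> i j * l n j g k * B n ! k)"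
        using g by (intro sum.cong refl) (simp add: l sum_distrib_left mult.assoc)
      also have "\<dots> = (\<Sum>k<length (B n). \<Sum>j<m. \<alpha> i j * l n j g k * B n ! k)"
        by (rule sum.swap)
      also have "\<dots> = (\<Sum>k<length (B n). M n \<alpha> $$ (p, k) * B n ! k)"
        using p by (intro sum.cong refl) (simp add: M_def ig sum_distrib_right)
      finally show "?c (fst (rs n ! p)) * monomial_value a (snd (rs n ! p))
        = (\<Sum>k<length (B n). M n \<alpha> $$ (p, k) * B n ! k)" by (simp add: ig)
    qed
    then show ?thesis unfolding \<Phi>(2) by blast
  qed
  show ?thesis
  proof (rule exI[of _ N], intro allI impI)
    fix Q assume "reduction class_ring Q A"
    then obtain n where Q: "idl.subspace Q" "Q \<subseteq> A"
      and step: "ideal_pow class_ring A (n + 1) = ideal_prod class_ring Q (ideal_pow class_ring A n)"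
      by (auto simp: reduction_def ideal_class_ring_iff)
    obtain Y where Y: "finite Y" "Y \<subseteq> Q" "card Y \<le> card (a ` {..<m})"
      "Q \<subseteq> idl.span (Y \<union> ideal_prod class_ring \<mm> A)"
      using generators_mod_max_ideal[OF Q A_span] by auto
    have "card Y \<le> m" using Y(3) card_image_le[of "{..<m}" a] by simp
    obtain y where y: "bij_betw y {..<card Y} Y"
      using ex_bij_betw_nat_finite[OF Y(1)] by (auto simp: atLeast0LessThan)
    \<comment> \<open>Padding with 0 gives exactly \<open>m\<close> generators, the format of the
      parameter space.\<close>
    define c where "c i = (if i < card Y then y i else 0)" for i
    have c_mem: "c i \<in> Q" for i
      using y Y(2) idl.subspace_0[OF Q(1)] by (auto simp: c_def bij_betw_def)
    have "\<exists>f. c i = (\<Sum>j<m. f j * a j)" for i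
      using c_mem Q(2) unfolding A_span by (intro idl.span_image_sum) auto
    then obtain \<alpha> where \<alpha>: "c = (\<lambda>i. \<Sum>j<m. \<alpha> i j * a j)" by metis
    let ?Q' = "ideal_gen_by m c"
    have Q': "?Q' \<subseteq> Q"
      unfolding ideal_gen_by_eq_span using c_mem Q by (intro idl.span_minimal) auto
    have "Y \<subseteq> c ` {..<m}"
    proof
      fix z assume "z \<in> Y"
      then obtain i where "i < card Y" "z = y i" using y by (auto simp: bij_betw_def)
      then show "z \<in> c ` {..<m}" using \<open>card Y \<le> m\<close> by (intro image_eqI[of _ _ i]) (auto simp: c_def)
    qed
    then have "Y \<subseteq> ?Q'" using idl.span_superset by (auto simp: ideal_gen_by_eq_span)
    then have "Q \<subseteq> idl.span (?Q' \<union> ideal_prod class_ring \<mm> A)"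
      using Y(4) idl.span_mono[of "Y \<union> _" "?Q' \<union> ideal_prod class_ring \<mm> A"] by blast
    then have "ideal_pow class_ring A (n + 1) = ideal_prod class_ring ?Q' (ideal_pow class_ring A n)"
      using Q Q' by (intro reduction_step_mod_max_ideal[OF A fg subspace_ideal_gen_by _ _ step]) auto
    then obtain \<phi> where \<phi>: "\<phi> \<in> \<Phi> n" "\<phi> \<alpha> \<notin> \<mm>" using step_iff[of n \<alpha>] \<alpha> by auto
    from \<phi>(1) S(3) have "\<phi> \<in> lin_span R S" by blast
    then have "\<exists>\<psi>\<in>S. \<psi> \<alpha> \<notin> \<mm>"
      using lin_span_eval_mem[of \<phi> R S \<alpha>] \<phi>(2) by metis
    then obtain \<psi> where \<psi>: "\<psi> \<in> S" "\<psi> \<alpha> \<notin> \<mm>" by blast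
    then have "ideal_pow class_ring A (deg \<psi> + 1)
        = ideal_prod class_ring ?Q' (ideal_pow class_ring A (deg \<psi>))"
      using step_iff[of "deg \<psi>" \<alpha>] deg \<alpha> by auto
    \<comment> \<open>\<open>?Q'\<close> may be smaller than \<open>Q\<close>; the equation passes
      to the larger ideal.\<close>
    then have "ideal_pow class_ring A (deg \<psi> + 1) = ideal_prod class_ring Q (ideal_pow class_ring A (deg \<psi>))"
      using reduction_step_mono[OF A Q(1) subspace_ideal_gen_by Q' Q(2)] by blast
    then show "\<exists>n\<le>N. ideal_pow class_ring A (n + 1) = ideal_prod class_ring Q (ideal_pow class_ring A n)"
      using N \<psi>(1) by blast
  qed
qed

end

section \<open>The dimension of the fiber cone\<close>

definition rees :: "'a::comm_ring_1 set \<Rightarrow> 'a poly set" where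
  "rees A = {p. \<forall>n. coeff p n \<in> ideal_pow class_ring A n}"

text \<open>The fiber cone is the Rees algebra modulo this homogeneous ideal.\<close>

definition rees_kernel :: "'a::comm_ring_1 set \<Rightarrow> 'a set \<Rightarrow> 'a poly set" where
  "rees_kernel \<mm> A = {p. \<forall>n. coeff p n \<in> ideal_prod class_ring \<mm> (ideal_pow class_ring A n)}"

text \<open>The primes of the Rees algebra above the kernel, that is, those coming from the fiber
  cone, spelled out so that the computation stays with polynomials.\<close>

definition rees_prime :: "'a::comm_ring_1 set \<Rightarrow> 'a set \<Rightarrow> 'a poly set \<Rightarrow> bool" where
  "rees_prime \<mm> A P \<longleftrightarrow> rees_kernel \<mm> A \<subseteq> P \<and> P \<subseteq> rees A \<and> 1 \<notin> P \<and>
    (\<forall>p\<in>P. \<forall>q\<in>P. p + q \<in> P) \<and> (\<forall>r\<in>rees A. \<forall>p\<in>P. r * p \<in> P) \<and>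
    (\<forall>p\<in>rees A. \<forall>q\<in>rees A. p * q \<in> P \<longrightarrow> p \<in> P \<or> q \<in> P)"

context
  fixes A :: "'a::comm_ring_1 set"
  assumes A: "idl.subspace A"
begin

lemma one_mem_rees: "1 \<in> rees A"
  using idl.subspace_0[OF subspace_ideal_pow[OF A]]
  by (auto simp: rees_def ideal_pow_0 coeff_1)

lemma add_mem_rees: "p \<in> rees A \<Longrightarrow> q \<in> rees A \<Longrightarrow> p + q \<in> rees A"
  using idl.subspace_add[OF subspace_ideal_pow[OF A]] by (auto simp: rees_def)

lemma smult_mem_rees: "p \<in> rees A \<Longrightarrow> Polynomial.smult c p \<in> rees A"
  using idl.subspace_scale[OF subspace_ideal_pow[OF A]] by (auto simp: rees_def)

lemma mult_mem_rees: "p \<in> rees A \<Longrightarrow> q \<in> rees A \<Longrightarrow> p * q \<in> rees A"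
  unfolding rees_def
proof clarify
  fix n assume p: "\<forall>n. coeff p n \<in> ideal_pow class_ring A n"
    and q: "\<forall>n. coeff q n \<in> ideal_pow class_ring A n"
  have "coeff p i * coeff q (n - i) \<in> ideal_pow class_ring A n" if "i \<in> {..n}" for i
    using mult_mem_ideal_pow[OF A p[rule_format, of i] q[rule_format, of "n - i"]] that by simp
  then show "coeff (p * q) n \<in> ideal_pow class_ring A n"
    unfolding coeff_mult by (intro idl.subspace_sum subspace_ideal_pow A)
qed

lemma prod_mem_rees: "(\<And>i. i \<in> S \<Longrightarrow> f i \<in> rees A) \<Longrightarrow> prod f S \<in> rees A"
  by (induction S rule: infinite_finite_induct) (auto intro: one_mem_rees mult_mem_rees)

lemma power_mem_rees: "p \<in> rees A \<Longrightarrow> p ^ n \<in> rees A"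
  by (induction n) (auto intro: one_mem_rees mult_mem_rees)

lemma sum_mem_rees: "(\<And>i. i \<in> S \<Longrightarrow> f i \<in> rees A) \<Longrightarrow> sum f S \<in> rees A"
  using idl.subspace_0[OF subspace_ideal_pow[OF A]]
  by (induction S rule: infinite_finite_induct) (auto intro: idl.subspace_add[OF subspace_ideal_pow[OF A]] simp: rees_def)

lemma monom_mem_rees: "x \<in> ideal_pow class_ring A n \<Longrightarrow> monom x n \<in> rees A"
  using idl.subspace_0[OF subspace_ideal_pow[OF A]] by (auto simp: rees_def)

end

lemma rees_primeD:
  assumes "rees_prime \<mm> A P"
  shows "rees_kernel \<mm> A \<subseteq> P" "P \<subseteq> rees A" "1 \<notin> P" "p \<in> P \<Longrightarrow> q \<in> P \<Longrightarrow> p + q \<in> P"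
    "r \<in> rees A \<Longrightarrow> p \<in> P \<Longrightarrow> r * p \<in> P"
    "p \<in> rees A \<Longrightarrow> q \<in> rees A \<Longrightarrow> p * q \<in> P \<Longrightarrow> p \<in> P \<or> q \<in> P"
  using assms by (auto simp: rees_prime_def)

context local_ideal
begin

lemma subspace_rees_kernel:
  assumes "idl.subspace A"
  shows "Modules.module.subspace Polynomial.smult (rees_kernel \<mm> A)"
proof -
  interpret P: Modules.module Polynomial.smult
    by standard (simp_all add: smult_add_right smult_add_left)
  have "idl.subspace (ideal_prod class_ring \<mm> (ideal_pow class_ring A n))" for n
    by (intro subspace_ideal_prod subspace_max_ideal subspace_ideal_pow assms)
  then show ?thesis
    by (intro P.subspaceI) (auto simp: rees_kernel_def idl.subspace_0 idl.subspace_add idl.subspace_scale)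
qed

lemma smult_mem_rees_kernel:
  "\<mu> \<in> \<mm> \<Longrightarrow> p \<in> rees A \<Longrightarrow> Polynomial.smult \<mu> p \<in> rees_kernel \<mm> A"
  by (auto simp: rees_def rees_kernel_def intro: mult_mem_ideal_prod)

text \<open>The relation is a polynomial identity in the \<open>x j\<close>. Modulo \<open>P i\<close> one may cancel the smallest
  power of \<open>x i\<close> occurring in it, and modulo \<open>P (i + 1)\<close> only the terms with this power survive.\<close>

lemma monomials_independent_mod_prime_chain:
  assumes A: "idl.subspace A" and P: "\<And>i. i \<le> Suc s \<Longrightarrow> rees_prime \<mm> A (P i)"
    and mono: "\<And>i. i \<le> s \<Longrightarrow> P i \<subseteq> P (Suc i)"
    and x: "\<And>i. i \<le> s \<Longrightarrow> x i \<in> P (Suc i) - P i"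
    and "i \<le> Suc s" "finite S" "S \<noteq> {}" "\<And>t. t \<in> S \<Longrightarrow> l t \<notin> \<mm>" "S \<subseteq> {..s} \<rightarrow>\<^sub>E (UNIV :: nat set)"
    and "\<And>t t' j. t \<in> S \<Longrightarrow> t' \<in> S \<Longrightarrow> j < i \<Longrightarrow> t j = t' j"
  shows "(\<Sum>t\<in>S. Polynomial.smult (l t) (\<Prod>j\<in>{i..s}. x j ^ t j)) \<notin> P i"
  using assms(5-)
proof (induction i arbitrary: S rule: inc_induct)
  case base
  \<comment> \<open>At the top the exponents agree on all of \<open>{..s}\<close>, so extensionality
    leaves a single term with an empty product: a unit times 1.\<close>
  from base.prems obtain t where t: "t \<in> S" by blast
  have "t' = t" if "t' \<in> S" for t'
  proof (rule PiE_ext)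
    show "t' \<in> {..s} \<rightarrow>\<^sub>E UNIV" "t \<in> {..s} \<rightarrow>\<^sub>E UNIV" using base.prems that t by auto
    show "t' j = t j" if "j \<in> {..s}" for j using base.prems(5)[OF \<open>t' \<in> S\<close> t] that by auto
  qed
  then have S: "S = {t}" using t by blast
  obtain v where v: "v * l t = 1" using inverse_outside base.prems(3)[OF t] by blast
  show ?case
  proof
    assume "(\<Sum>t\<in>S. Polynomial.smult (l t) (\<Prod>j\<in>{Suc s..s}. x j ^ t j)) \<in> P (Suc s)"
    then have "Polynomial.smult (l t) 1 \<in> P (Suc s)" by (simp add: S)
    then have "Polynomial.smult v 1 * Polynomial.smult (l t) 1 \<in> P (Suc s)"
      by (intro rees_primeD(5)[OF P] smult_mem_rees one_mem_rees A) auto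
    moreover have "Polynomial.smult v 1 * Polynomial.smult (l t) 1 = 1"
      using v by (simp add: mult.commute one_pCons)
    ultimately show False using rees_primeD(3)[OF P, of "Suc s"] by simp
  qed
next
  case (step i)
  have i: "i \<le> s" using step.hyps by simp
  have Pi: "rees_prime \<mm> A (P i)" "rees_prime \<mm> A (P (Suc i))" using P i by auto
  have x_rees: "x j \<in> rees A" if "j \<le> s" for j
    using x[OF that] rees_primeD(2)[OF P, of "Suc j"] that by auto
  \<comment> \<open>The smallest exponent of \<open>x i\<close>. Factoring out
    \<open>x i ^ e\<close> leaves \<open>u + r\<close>, where \<open>r\<close> collects the terms
    still carrying a positive power of \<open>x i\<close> and so lies in
    \<open>P (Suc i)\<close>.\<close>
  define e where "e = Min ((\<lambda>t. t i) ` S)"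
  have e: "e \<le> t i" if "t \<in> S" for t using that step.prems by (simp add: e_def)
  define S' where "S' = {t \<in> S. t i = e}"
  have "e \<in> (\<lambda>t. t i) ` S" unfolding e_def using step.prems by (intro Min_in) auto
  then have "S' \<noteq> {}" by (auto simp: S'_def)
  define y where "y t = Polynomial.smult (l t) (\<Prod>j\<in>{Suc i..s}. x j ^ t j)" for t
  have y: "y t \<in> rees A" for t
    unfolding y_def by (intro smult_mem_rees prod_mem_rees power_mem_rees A x_rees) auto
  have IH: "(\<Sum>t\<in>S'. y t) \<notin> P (Suc i)"
    unfolding y_def
  proof (rule step.IH)
    show "t j = t' j" if "t \<in> S'" "t' \<in> S'" "j < Suc i" for t t' j
      using that step.prems(5)[of t t' j] by (cases "j = i") (auto simp: S'_def)
  qed (use step.prems \<open>S' \<noteq> {}\<close> in \<open>auto simp: S'_def\<close>)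
  define u where "u = (\<Sum>t\<in>S'. y t)"
  define r where "r = (\<Sum>t\<in>S - S'. x i ^ (t i - e) * y t)"
  have sum_mem: "(\<Sum>t\<in>F. f t) \<in> P (Suc i)" if "\<And>t. t \<in> F \<Longrightarrow> f t \<in> P (Suc i)" for F and f :: "(nat \<Rightarrow> nat) \<Rightarrow> 'a poly"
    using that
  proof (induction F rule: infinite_finite_induct)
    case (insert t F)
    then show ?case by (simp add: rees_primeD(4)[OF Pi(2)])
  qed (use rees_primeD(1)[OF Pi(2)] idl.subspace_0 in
      \<open>auto simp: rees_kernel_def subset_iff idl.subspace_0[OF subspace_ideal_prod[OF subspace_max_ideal subspace_ideal_pow[OF A]]]\<close>)
  have r: "r \<in> P (Suc i)"
    unfolding r_def
  proof (rule sum_mem)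
    fix t assume t: "t \<in> S - S'"
    then obtain k where k: "t i - e = Suc k" using e[of t] by (cases "t i - e") (auto simp: S'_def)
    have "(y t * x i ^ k) * x i \<in> P (Suc i)"
      using x[OF i] by (intro rees_primeD(5)[OF Pi(2)] mult_mem_rees power_mem_rees A y x_rees i) auto
    then show "x i ^ (t i - e) * y t \<in> P (Suc i)" unfolding k by (simp add: mult_ac)
  qed
  show ?case
  proof
    assume mem: "(\<Sum>t\<in>S. Polynomial.smult (l t) (\<Prod>j\<in>{i..s}. x j ^ t j)) \<in> P i"
    have "{i..s} = insert i {Suc i..s}" using i by auto
    then have "Polynomial.smult (l t) (\<Prod>j\<in>{i..s}. x j ^ t j) = x i ^ t i * y t" for t
      by (simp add: y_def)
    moreover have "x i ^ t i * y t = x i ^ e * (x i ^ (t i - e) * y t)" if "t \<in> S" for t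
      using e[OF that] by (simp add: mult.assoc[symmetric] flip: power_add)
    ultimately have "(\<Sum>t\<in>S. Polynomial.smult (l t) (\<Prod>j\<in>{i..s}. x j ^ t j))
        = x i ^ e * (\<Sum>t\<in>S. x i ^ (t i - e) * y t)"
      unfolding sum_distrib_left by (intro sum.cong) auto
    also have "(\<Sum>t\<in>S. x i ^ (t i - e) * y t) = r + (\<Sum>t\<in>S'. x i ^ (t i - e) * y t)"
      unfolding r_def using step.prems(1) by (intro sum.subset_diff) (auto simp: S'_def)
    also have "(\<Sum>t\<in>S'. x i ^ (t i - e) * y t) = u"
      unfolding u_def by (intro sum.cong) (auto simp: S'_def)
    also have "r + u = u + r" by simp
    finally have "x i ^ e * (u + r) \<in> P i" using mem by simp
    moreover have "u + r \<in> rees A"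
      unfolding u_def r_def
      by (intro add_mem_rees sum_mem_rees mult_mem_rees power_mem_rees A y x_rees i)
    moreover have "x i ^ k \<notin> P i" for k
    proof (induction k)
      case 0
      then show ?case using rees_primeD(3)[OF Pi(1)] by simp
    next
      case (Suc k)
      then show ?case
        using rees_primeD(6)[OF Pi(1) x_rees[OF i] power_mem_rees[OF A x_rees[OF i]]] x[OF i] by auto
    qed
    ultimately have "u + r \<in> P i"
      using rees_primeD(6)[OF Pi(1) power_mem_rees[OF A x_rees[OF i]]] by blast
    then have "u + r \<in> P (Suc i)" using mono i by blast
    moreover have "- r \<in> P (Suc i)"
      using rees_primeD(5)[OF Pi(2) smult_mem_rees[OF A one_mem_rees[OF A], of "- 1"] r] by simp
    ultimately have "(u + r) + - r \<in> P (Suc i)" by (rule rees_primeD(4)[OF Pi(2)])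
    then show False using IH by (simp add: u_def)
  qed
qed

end

section \<open>Growth of the Rees algebra over a reduction\<close>

lemma exists_power_dominating:
  fixes w b s :: nat
  shows "\<exists>N. (b * N + 1) ^ s * w < N ^ Suc s"
proof -
  \<comment> \<open>As \<open>N > 0\<close>, \<open>b * N + 1 \<le> (b + 1) * N\<close>; the choice
    makes the one extra factor \<open>N\<close> exceed the constant
    \<open>(b + 1) ^ s * w\<close>.\<close>
  define N where "N = (b + 1) ^ s * w + 1"
  have "(b * N + 1) ^ s * w \<le> ((b + 1) * N) ^ s * w"
    by (intro mult_right_mono power_mono) (simp_all add: N_def)
  also have "\<dots> = (b + 1) ^ s * w * N ^ s" by (simp only: power_mult_distrib mult_ac)
  also have "\<dots> < N * N ^ s" by (intro mult_strict_right_mono) (simp_all add: N_def)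
  finally show ?thesis by (intro exI[of _ N]) simp
qed

text \<open>Bounding each exponent instead of the total degree gives a box, whose size is immediate
  and still has the right order of growth in \<open>n\<close>.\<close>

definition rees_generators :: "'a::comm_ring_1 set \<Rightarrow> 'a poly set \<Rightarrow> nat \<Rightarrow> 'a poly set" where
  "rees_generators C W n = (\<lambda>(t, w). (\<Prod>c\<in>C. monom c 1 ^ t c) * w) ` ((C \<rightarrow>\<^sub>E {..n}) \<times> W)"

lemma finite_rees_generators: "finite C \<Longrightarrow> finite W \<Longrightarrow> finite (rees_generators C W n)"
  unfolding rees_generators_def by (intro finite_imageI finite_cartesian_product finite_PiE) auto

lemma card_rees_generators:
  assumes "finite C" "finite W"
  shows "card (rees_generators C W n) \<le> (n + 1) ^ card C * card W"
proof -
  have "card (rees_generators C W n) \<le> card ((C \<rightarrow>\<^sub>E {..n}) \<times> W)"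
    unfolding rees_generators_def using assms by (intro card_image_le finite_cartesian_product finite_PiE) auto
  also have "\<dots> = (n + 1) ^ card C * card W"
    using assms by (simp add: card_cartesian_product card_PiE)
  finally show ?thesis .
qed

lemma rees_generators_mono:
  assumes "n \<le> k"
  shows "rees_generators C W n \<subseteq> rees_generators C W k"
  unfolding rees_generators_def using assms by (intro image_mono Sigma_mono PiE_mono) auto

lemma rees_generators_shift:
  assumes "c \<in> C" "finite C" "y \<in> rees_generators C W n"
  shows "monom c 1 * y \<in> rees_generators C W (Suc n)"
proof -
  obtain t w where t: "t \<in> C \<rightarrow>\<^sub>E {..n}" and w: "w \<in> W" and y: "y = (\<Prod>c\<in>C. monom c 1 ^ t c) * w"
    using assms(3) by (auto simp: rees_generators_def)
  let ?t = "t(c := Suc (t c))"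
  have "(\<Prod>b\<in>C. monom b 1 ^ ?t b) = monom c 1 * (\<Prod>b\<in>C. monom b 1 ^ t b)"
    using assms(1,2) by (simp add: prod.remove[of C c] mult.assoc)
  moreover have "?t \<in> C \<rightarrow>\<^sub>E {..Suc n}"
    using t assms(1) by (fastforce simp: PiE_iff extensional_def)
  ultimately show ?thesis
    unfolding rees_generators_def using w by (intro image_eqI[of _ _ "(?t, w)"]) (auto simp: y mult.assoc)
qed

text \<open>From exponent \<open>n0\<close> on, each power of \<open>A\<close> is the previous one
  times the ideal generated by \<open>C\<close>, so the Rees algebra is a finite module over the
  subalgebra generated by \<open>C\<close> in degree 1. \<open>W\<close> consists of generators of
  the powers up to \<open>n0\<close>; each further degree raises one exponent by 1, which keeps all
  exponents at most \<open>n\<close>.\<close>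

lemma rees_finite_over_reduction:
  assumes A: "idl.subspace A" and fg: "\<And>n. \<exists>S. finite S \<and> idl.span S = ideal_pow class_ring A n"
    and C: "finite C" "C \<subseteq> A"
    and step: "ideal_pow class_ring A (n0 + 1) = ideal_prod class_ring (idl.span C) (ideal_pow class_ring A n0)"
  obtains W where "finite W" "W \<subseteq> rees A"
    "\<And>n p. p \<in> rees A \<Longrightarrow> degree p \<le> n \<Longrightarrow>
      p \<in> Modules.module.span Polynomial.smult (rees_generators C W n)"
proof -
  interpret P: Modules.module Polynomial.smult
    by standard (simp_all add: smult_add_right smult_add_left)
  obtain G where G: "\<And>n. finite (G n)" "\<And>n. idl.span (G n) = ideal_pow class_ring A n"
    using fg by metis
  define W where "W = (\<Union>k\<le>n0. (\<lambda>g. monom g k) ` G k)"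
  have "W \<subseteq> rees A"
    using G(2) idl.span_superset by (fastforce simp: W_def intro!: monom_mem_rees A)
  have low: "monom y n \<in> P.span (rees_generators C W n)" if "n \<le> n0" "y \<in> ideal_pow class_ring A n" for n y
  proof -
    have "monom g n \<in> rees_generators C W n" if "g \<in> G n" for g
      unfolding rees_generators_def
      using that \<open>n \<le> n0\<close>
      by (intro image_eqI[of _ _ "(restrict (\<lambda>_. 0) C, monom g n)"]) (auto simp: W_def)
    moreover have "y \<in> idl.span (G n)" using that G by simp
    then have "monom y n \<in> P.span ((\<lambda>g. monom g n) ` G n)"
    proof (induction rule: idl.span_induct_alt)
      case base
      then show ?case by (simp add: P.span_zero)
    next
      case (step c g z)
      then have "Polynomial.smult c (monom g n) + monom z n \<in> P.span ((\<lambda>g. monom g n) ` G n)"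
        by (intro P.span_add[OF P.span_scale[OF P.span_base]]) auto
      then show ?case by (simp add: smult_monom add_monom)
    qed
    ultimately show ?thesis
      using P.span_mono[of "(\<lambda>g. monom g n) ` G n" "rees_generators C W n"] by auto
  qed
  have high: "monom y n \<in> P.span (rees_generators C W n)" if "n0 \<le> n" "y \<in> ideal_pow class_ring A n" for n y
    using that
  proof (induction n arbitrary: y rule: dec_induct)
    case base
    then show ?case by (intro low) auto
  next
    case (step n)
    have C_step: "monom (c * z) (Suc n) \<in> P.span (rees_generators C W (Suc n))"
      if "c \<in> C" "z \<in> ideal_pow class_ring A n" for c z
    proof -
      have "monom c 1 * p \<in> P.span (rees_generators C W (Suc n))"
        if "p \<in> P.span (rees_generators C W n)" for p
        using that
      proof (induction rule: P.span_induct_alt)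
        case (step d p q)
        then have "Polynomial.smult d (monom c 1 * p) + monom c 1 * q \<in> P.span (rees_generators C W (Suc n))"
          using rees_generators_shift[OF \<open>c \<in> C\<close> C(1)] by (intro P.span_add[OF P.span_scale[OF P.span_base]])
        then show ?case by (simp add: distrib_left)
      qed (simp add: P.span_zero)
      from this[OF step.IH[OF that(2)]] show ?thesis by (simp add: mult_monom)
    qed
    have "y \<in> ideal_prod class_ring (idl.span C) (ideal_pow class_ring A n)"
      using step.prems reduction_step_Suc[OF A idl.subspace_span assms(5) step.hyps(1)] by simp
    then show ?case
    proof induction
      case (prod q z)
      from prod(1) have "monom (q * z) (Suc n) \<in> P.span (rees_generators C W (Suc n))"
      proof (induction rule: idl.span_induct_alt)
        case base
        then show ?case by (simp add: P.span_zero)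
      next
        case (step d c q)
        then have "Polynomial.smult d (monom (c * z) (Suc n)) + monom (q * z) (Suc n)
            \<in> P.span (rees_generators C W (Suc n))"
          using C_step[OF _ prod(2)] by (intro P.span_add P.span_scale[OF C_step]) (use prod in auto)
        then show ?case by (simp add: smult_monom add_monom distrib_right mult.assoc)
      qed
      then show ?case by simp
    next
      case (sum p q)
      then show ?case using P.span_add by (fastforce simp: add_monom[symmetric])
    qed
  qed
  have "p \<in> P.span (rees_generators C W n)" if "p \<in> rees A" "degree p \<le> n" for p n
  proof -
    have "monom (coeff p i) i \<in> P.span (rees_generators C W n)" if "i \<le> degree p" for i
      using low[of i "coeff p i"] high[of i "coeff p i"] that \<open>p \<in> rees A\<close> \<open>degree p \<le> n\<close>
        P.span_mono[OF rees_generators_mono[of i n C W]]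
      by (cases "i \<le> n0") (auto simp: rees_def)
    then have "(\<Sum>i\<le>degree p. monom (coeff p i) i) \<in> P.span (rees_generators C W n)"
      by (intro P.span_sum) auto
    then show ?thesis by (simp add: poly_as_sum_of_monoms)
  qed
  moreover have "finite W" using G by (simp add: W_def)
  ultimately show thesis using \<open>W \<subseteq> rees A\<close> that by blast
qed

context local_ideal
begin

text \<open>For \<open>s\<close> generators of a reduction, the part of the Rees algebra in degrees up to \<open>N\<close> has
  \<open>O(N\<^sup>s)\<close> generators, whereas \<open>s + 1\<close> elements have \<open>N\<^sup>s\<^sup>+\<^sup>1\<close> monomials with exponents below \<open>N\<close>.
  So these monomials are dependent modulo the kernel.\<close>

lemma no_long_prime_chain:
  assumes A: "idl.subspace A" and fg: "\<And>n. \<exists>S. finite S \<and> idl.span S = ideal_pow class_ring A n"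
    and C: "finite C" "C \<subseteq> A"
    and step: "ideal_pow class_ring A (n0 + 1) = ideal_prod class_ring (idl.span C) (ideal_pow class_ring A n0)"
    and P: "\<And>i. i \<le> Suc (card C) \<Longrightarrow> rees_prime \<mm> A (P i)"
    and mono: "\<And>i. i \<le> card C \<Longrightarrow> P i \<subset> P (Suc i)"
  shows False
proof -
  interpret P: local_module Polynomial.smult \<mm>
    by standard (simp_all add: smult_add_right smult_add_left)
  define s where "s = card C"
  obtain W where W: "finite W" "W \<subseteq> rees A"
    and span: "\<And>n p. p \<in> rees A \<Longrightarrow> degree p \<le> n \<Longrightarrow> p \<in> P.span (rees_generators C W n)"
    using rees_finite_over_reduction[OF A fg C step] by blast
  have "\<exists>x. x \<in> P (Suc i) - P i" if "i \<le> s" for i using mono that unfolding s_def by blast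
  then obtain x where x: "\<And>i. i \<le> s \<Longrightarrow> x i \<in> P (Suc i) - P i" by metis
  have x_rees: "x i \<in> rees A" if "i \<le> s" for i
    using x[OF that] rees_primeD(2)[OF P, of "Suc i"] that by (auto simp: s_def)
  define e where "e = Max ((\<lambda>i. degree (x i)) ` {..s})"
  have e: "degree (x i) \<le> e" if "i \<le> s" for i using that by (simp add: e_def)
  obtain N where N: "((s + 1) * e * N + 1) ^ s * card W < N ^ Suc s"
    using exists_power_dominating by blast
  \<comment> \<open>A monomial in the \<open>s + 1\<close> elements with exponents below
    \<open>N\<close> has degree at most \<open>?D\<close>; the inequality for \<open>N\<close> is
    the case \<open>b = (s + 1) * e\<close> of \<open>exists_power_dominating\<close>.\<close>
  let ?D = "(s + 1) * e * N"
  define T where "T = {..s} \<rightarrow>\<^sub>E {..<N}"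
  define X where "X t = (\<Prod>j\<in>{0..s}. x j ^ t j)" for t :: "nat \<Rightarrow> nat"
  have X_rees: "X t \<in> rees A" for t
    unfolding X_def by (intro prod_mem_rees power_mem_rees A x_rees) auto
  have X_degree: "degree (X t) \<le> ?D" if "t \<in> T" for t
  proof -
    have "degree (X t) \<le> (\<Sum>j\<in>{0..s}. degree (x j ^ t j))"
      unfolding X_def using degree_prod_sum_le[of "{0..s}" "\<lambda>j. x j ^ t j"] by (simp add: comp_def)
    also have "\<dots> \<le> (\<Sum>j\<in>{0..s}. e * N)"
    proof (rule sum_mono)
      fix j assume j: "j \<in> {0..s}"
      have "degree (x j ^ t j) \<le> degree (x j) * t j" by (rule degree_power_le)
      also have "\<dots> \<le> e * N" using e j that by (intro mult_mono) (auto simp: T_def PiE_iff less_imp_le)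
      finally show "degree (x j ^ t j) \<le> e * N" .
    qed
    finally show ?thesis by (simp add: algebra_simps)
  qed
  have gens_rees: "y \<in> rees A" if "y \<in> rees_generators C W n" for y n
  proof -
    have "monom c 1 \<in> rees A" if "c \<in> C" for c
      using that C(2) mult_mem_ideal_prod[of 1 UNIV c A]
      by (intro monom_mem_rees A) (auto simp: ideal_pow_Suc ideal_pow_0)
    with that W(2) show ?thesis
      unfolding rees_generators_def by (auto intro!: mult_mem_rees prod_mem_rees power_mem_rees A)
  qed
  have "\<exists>l. (\<exists>t\<in>T. l t \<notin> \<mm>) \<and> (\<Sum>t\<in>T. Polynomial.smult (l t) (X t)) \<in> rees_kernel \<mm> A"
  proof (rule P.linear_dependence)
    show "finite (rees_generators C W ?D)" using finite_rees_generators C W by blast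
    show "P.subspace (rees_kernel \<mm> A)" by (rule subspace_rees_kernel[OF A])
    show "finite T" unfolding T_def by (intro finite_PiE) auto
    have "card T = N ^ Suc s" by (simp add: T_def card_PiE)
    then show "card (rees_generators C W ?D) < card T"
      using card_rees_generators[OF C(1) W(1), of ?D] N by (simp add: s_def)
    show "X t \<in> P.span (rees_generators C W ?D \<union> rees_kernel \<mm> A)" if "t \<in> T" for t
      by (rule subsetD[OF P.span_mono span[OF X_rees X_degree[OF that]]]) simp
    show "Polynomial.smult \<mu> y \<in> rees_kernel \<mm> A" if "\<mu> \<in> \<mm>" "y \<in> rees_generators C W ?D" for \<mu> y
      using that by (intro smult_mem_rees_kernel gens_rees)
  qed
  then obtain l where l: "\<exists>t\<in>T. l t \<notin> \<mm>" "(\<Sum>t\<in>T. Polynomial.smult (l t) (X t)) \<in> rees_kernel \<mm> A"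
    by (elim exE conjE) (rule that)
  define S where "S = {t \<in> T. l t \<notin> \<mm>}"
  have T: "finite T" unfolding T_def by (intro finite_PiE) auto
  have ker: "P.subspace (rees_kernel \<mm> A)" by (rule subspace_rees_kernel[OF A])
  have "(\<Sum>t\<in>T - S. Polynomial.smult (l t) (X t)) \<in> rees_kernel \<mm> A"
    by (intro P.subspace_sum[OF ker] smult_mem_rees_kernel X_rees) (auto simp: S_def)
  then have "(\<Sum>t\<in>T. Polynomial.smult (l t) (X t)) - (\<Sum>t\<in>T - S. Polynomial.smult (l t) (X t)) \<in> rees_kernel \<mm> A"
    by (rule P.subspace_diff[OF ker l(2)])
  also have "(\<Sum>t\<in>T. Polynomial.smult (l t) (X t)) - (\<Sum>t\<in>T - S. Polynomial.smult (l t) (X t))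
      = (\<Sum>t\<in>S. Polynomial.smult (l t) (X t))"
    using T by (subst sum.subset_diff[of S T]) (auto simp: S_def)
  finally have "(\<Sum>t\<in>S. Polynomial.smult (l t) (\<Prod>j\<in>{0..s}. x j ^ t j)) \<in> P 0"
    using rees_primeD(1)[OF P, of 0] by (auto simp: X_def)
  moreover have "(\<Sum>t\<in>S. Polynomial.smult (l t) (\<Prod>j\<in>{0..s}. x j ^ t j)) \<notin> P 0"
  proof (rule monomials_independent_mod_prime_chain[OF A, where P = P])
    show "finite S" using T by (simp add: S_def)
    show "S \<noteq> {}" using l(1) by (auto simp: S_def)
    show "S \<subseteq> {..s} \<rightarrow>\<^sub>E UNIV" by (auto simp: S_def T_def)
    show "P i \<subseteq> P (Suc i)" if "i \<le> s" for i using mono that by (auto simp: s_def)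
  qed (use P x in \<open>auto simp: s_def S_def\<close>)
  ultimately show False by blast
qed

end

section \<open>The fiber cone as an image of the Rees algebra\<close>

lemma coset_class_ring: "I +>\<^bsub>class_ring\<^esub> x = (\<lambda>i. i + x) ` I"
  by (auto simp: a_r_coset_def')

lemma coset_eq_iff:
  assumes "idl.subspace I"
  shows "I +>\<^bsub>class_ring\<^esub> x = I +>\<^bsub>class_ring\<^esub> y \<longleftrightarrow> x - y \<in> I"
proof
  assume "I +>\<^bsub>class_ring\<^esub> x = I +>\<^bsub>class_ring\<^esub> y"
  moreover have "x \<in> I +>\<^bsub>class_ring\<^esub> x"
    using idl.subspace_0[OF assms] by (force simp: coset_class_ring)
  ultimately show "x - y \<in> I" by (auto simp: coset_class_ring)
next
  have sub: "I +>\<^bsub>class_ring\<^esub> x \<subseteq> I +>\<^bsub>class_ring\<^esub> y" if "x - y \<in> I" for x y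
  proof
    fix z assume "z \<in> I +>\<^bsub>class_ring\<^esub> x"
    then obtain i where i: "i \<in> I" "z = i + x" by (auto simp: coset_class_ring)
    then have "i + (x - y) \<in> I" using idl.subspace_add[OF assms] that by blast
    then show "z \<in> I +>\<^bsub>class_ring\<^esub> y"
      unfolding coset_class_ring i by (intro image_eqI[of _ _ "i + (x - y)"]) simp_all
  qed
  assume "x - y \<in> I"
  then show "I +>\<^bsub>class_ring\<^esub> x = I +>\<^bsub>class_ring\<^esub> y"
    using sub[of x y] sub[of y x] idl.subspace_neg[OF assms, of "x - y"] by auto
qed

lemma coset_eq_self_iff:
  assumes "idl.subspace I"
  shows "I +>\<^bsub>class_ring\<^esub> x = I \<longleftrightarrow> x \<in> I"
  using coset_eq_iff[OF assms, of x 0] by (simp add: coset_class_ring)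

lemma sum_coset_Quot:
  assumes "idl.subspace I"
  shows "finsum (class_ring Quot I) (\<lambda>i. I +>\<^bsub>class_ring\<^esub> z i) S = I +>\<^bsub>class_ring\<^esub> (\<Sum>i\<in>S. z i)"
proof -
  have I: "ideal I class_ring" using assms by (simp add: ideal_class_ring_iff)
  interpret Q: ring_hom_cring class_ring "class_ring Quot I" "(+>\<^bsub>class_ring\<^esub>) I"
    by (rule ideal.rcos_ring_hom_cring[OF I class_cring.is_cring])
  show ?thesis using Q.hom_finsum[of z S] by (simp add: class_ring_simps comp_def)
qed

definition fiber_proj :: "'a::comm_ring_1 set \<Rightarrow> 'a set \<Rightarrow> 'a poly \<Rightarrow> nat \<Rightarrow> 'a set" where
  "fiber_proj \<mm> A p = (\<lambda>n. ideal_prod class_ring \<mm> (ideal_pow class_ring A n) +>\<^bsub>class_ring\<^esub> coeff p n)"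

context local_ideal
begin

context
  fixes A :: "'a set"
  assumes A: "idl.subspace A"
begin

abbreviation (input) "\<FF> \<equiv> fiber_cone class_ring \<mm> A"
abbreviation (input) "\<II> n \<equiv> ideal_prod class_ring \<mm> (ideal_pow class_ring A n)"

lemma subspace_max_pow: "idl.subspace (\<II> n)"
  by (intro subspace_ideal_prod subspace_max_ideal subspace_ideal_pow A)

lemma fiber_proj_carrier:
  assumes "p \<in> rees A"
  shows "fiber_proj \<mm> A p \<in> carrier \<FF>"
proof -
  have "{n. fiber_proj \<mm> A p n \<noteq> \<II> n} \<subseteq> {..degree p}"
    using idl.subspace_0[OF subspace_max_pow]
    by (auto simp: fiber_proj_def coset_eq_self_iff[OF subspace_max_pow] intro!: le_degree)
  then have "finite {n. fiber_proj \<mm> A p n \<noteq> \<II> n}" by (rule finite_subset) simp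
  then show ?thesis using assms
    by (auto simp: fiber_cone_def Let_def fiber_proj_def rees_def)
qed

lemma fiber_proj_surj:
  assumes "f \<in> carrier \<FF>"
  obtains p where "p \<in> rees A" "fiber_proj \<mm> A p = f"
proof -
  have f: "\<And>n. f n \<in> (\<lambda>x. \<II> n +>\<^bsub>class_ring\<^esub> x) ` ideal_pow class_ring A n"
    and fin: "finite {n. f n \<noteq> \<II> n}"
    using assms by (simp_all add: fiber_cone_def Let_def)
  then have "\<forall>n. \<exists>y. y \<in> ideal_pow class_ring A n \<and> f n = \<II> n +>\<^bsub>class_ring\<^esub> y" by blast
  then obtain y where y: "\<And>n. y n \<in> ideal_pow class_ring A n" "\<And>n. f n = \<II> n +>\<^bsub>class_ring\<^esub> y n"
    by metis
  \<comment> \<open>Only the finitely many nonzero components get a representative, so the result is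
    a polynomial.\<close>
  define p where "p = (\<Sum>n | f n \<noteq> \<II> n. monom (y n) n)"
  have coeff: "coeff p n = (if f n \<noteq> \<II> n then y n else 0)" for n
    using fin by (simp add: p_def coeff_sum coeff_monom)
  have "p \<in> rees A"
    using y(1) idl.subspace_0[OF subspace_ideal_pow[OF A]] by (auto simp: rees_def coeff)
  moreover have "fiber_proj \<mm> A p = f"
  proof
    fix n
    show "fiber_proj \<mm> A p n = f n"
      using y(2)[of n] coset_eq_self_iff[OF subspace_max_pow, of n 0] idl.subspace_0[OF subspace_max_pow, of n]
      by (auto simp: fiber_proj_def coeff)
  qed
  ultimately show thesis by (rule that)
qed

lemma fiber_proj_add:
  "fiber_proj \<mm> A (p + q) = fiber_proj \<mm> A p \<oplus>\<^bsub>\<FF>\<^esub> fiber_proj \<mm> A q"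
proof -
  have "\<II> n +>\<^bsub>class_ring\<^esub> (x + y) = (\<II> n +>\<^bsub>class_ring\<^esub> x) \<oplus>\<^bsub>class_ring Quot \<II> n\<^esub> (\<II> n +>\<^bsub>class_ring\<^esub> y)" for n x y
  proof -
    have I: "ideal (\<II> n) class_ring" using subspace_max_pow by (simp add: ideal_class_ring_iff)
    show ?thesis
      using ring_hom_add[OF ideal.rcos_ring_hom[OF I], of x y] by simp
  qed
  then show ?thesis by (simp add: fiber_cone_def Let_def fiber_proj_def)
qed

text \<open>The factors are cosets of different ideals, and \<open>rcoset_mult\<close> unites the
  cosets of all products of representatives. These cosets agree because \<open>\<II> i\<close> times
  \<open>A\<^sup>j\<close> lies in \<open>\<II> (i + j)\<close> and the representatives stay in the
  powers of \<open>A\<close>.\<close>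

lemma rcoset_mult_fiber:
  assumes x: "x \<in> ideal_pow class_ring A i" and y: "y \<in> ideal_pow class_ring A j"
  shows "rcoset_mult class_ring (\<II> (i + j)) (\<II> i +>\<^bsub>class_ring\<^esub> x) (\<II> j +>\<^bsub>class_ring\<^esub> y)
    = \<II> (i + j) +>\<^bsub>class_ring\<^esub> (x * y)"
proof -
  have sub: "\<II> k \<subseteq> ideal_pow class_ring A k" for k
    using idl.subspace_scale[OF subspace_ideal_pow[OF A]]
    by (intro ideal_prod_minimal subspace_ideal_pow A)
  have l: "\<mu> * z \<in> \<II> (i + j)" if "\<mu> \<in> \<II> i" "z \<in> ideal_pow class_ring A j" for \<mu> z i j
    using that(1)
  proof induction
    case (prod m b)
    have "m * (b * z) \<in> \<II> (i + j)"
      using prod mult_mem_ideal_pow[OF A prod(2) that(2)] by (intro mult_mem_ideal_prod)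
    then show ?case by (simp add: mult.assoc)
  next
    case (sum s t)
    then show ?case using idl.subspace_add[OF subspace_max_pow] by (simp add: distrib_right)
  qed
  have "\<II> (i + j) +>\<^bsub>class_ring\<^esub> ((\<mu> + x) * (\<nu> + y)) = \<II> (i + j) +>\<^bsub>class_ring\<^esub> (x * y)"
    if "\<mu> \<in> \<II> i" "\<nu> \<in> \<II> j" for \<mu> \<nu>
  proof -
    have "\<nu> + y \<in> ideal_pow class_ring A j"
      using that y sub idl.subspace_add[OF subspace_ideal_pow[OF A]] by blast
    then have "\<mu> * (\<nu> + y) + \<nu> * x \<in> \<II> (i + j)"
      using that l[of \<mu> i "\<nu> + y" j] l[of \<nu> j x i] x
      by (intro idl.subspace_add[OF subspace_max_pow]) (simp_all add: add.commute)
    then show ?thesis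
      unfolding coset_eq_iff[OF subspace_max_pow] by (simp add: algebra_simps)
  qed
  moreover have "\<II> i \<noteq> {}" "\<II> j \<noteq> {}" using idl.subspace_0[OF subspace_max_pow] by blast+
  ultimately show ?thesis
    unfolding rcoset_mult_def coset_class_ring[of "\<II> i"] coset_class_ring[of "\<II> j"] by simp
qed

lemma fiber_proj_mult:
  assumes "p \<in> rees A" "q \<in> rees A"
  shows "fiber_proj \<mm> A (p * q) = fiber_proj \<mm> A p \<otimes>\<^bsub>\<FF>\<^esub> fiber_proj \<mm> A q"
proof
  fix n
  have "(fiber_proj \<mm> A p \<otimes>\<^bsub>\<FF>\<^esub> fiber_proj \<mm> A q) n
    = finsum (class_ring Quot \<II> n) (\<lambda>i. rcoset_mult class_ring (\<II> n) (fiber_proj \<mm> A p i) (fiber_proj \<mm> A q (n - i))) {..n}"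
    by (simp add: fiber_cone_def Let_def)
  also have "\<dots> = finsum (class_ring Quot \<II> n) (\<lambda>i. \<II> n +>\<^bsub>class_ring\<^esub> (coeff p i * coeff q (n - i))) {..n}"
  proof (rule abelian_monoid.finsum_cong')
    have I: "ideal (\<II> n) class_ring" using subspace_max_pow by (simp add: ideal_class_ring_iff)
    show "abelian_monoid (class_ring Quot \<II> n)"
      using ideal.quotient_is_ring[OF I] ring.is_abelian_group abelian_group.axioms(1) by blast
    show "rcoset_mult class_ring (\<II> n) (fiber_proj \<mm> A p i) (fiber_proj \<mm> A q (n - i))
        = \<II> n +>\<^bsub>class_ring\<^esub> (coeff p i * coeff q (n - i))" if "i \<in> {..n}" for i
      using rcoset_mult_fiber[of "coeff p i" i "coeff q (n - i)" "n - i"] assms that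
      by (simp add: fiber_proj_def rees_def)
    show "(\<lambda>i. \<II> n +>\<^bsub>class_ring\<^esub> (coeff p i * coeff q (n - i))) \<in> {..n} \<rightarrow> carrier (class_ring Quot \<II> n)"
      using ring_hom_closed[OF ideal.rcos_ring_hom[OF I]] by simp
  qed simp
  also have "\<dots> = fiber_proj \<mm> A (p * q) n"
    by (simp add: sum_coset_Quot[OF subspace_max_pow] fiber_proj_def coeff_mult)
  finally show "fiber_proj \<mm> A (p * q) n = (fiber_proj \<mm> A p \<otimes>\<^bsub>\<FF>\<^esub> fiber_proj \<mm> A q) n" by simp
qed

lemma fiber_proj_one: "fiber_proj \<mm> A 1 = \<one>\<^bsub>\<FF>\<^esub>"
  by (auto simp: fiber_cone_def Let_def fiber_proj_def coeff_1 fun_eq_iff)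

lemma fiber_proj_kernel: "p \<in> rees_kernel \<mm> A \<Longrightarrow> fiber_proj \<mm> A p = \<zero>\<^bsub>\<FF>\<^esub>"
  by (auto simp: fiber_cone_def Let_def fiber_proj_def rees_kernel_def fun_eq_iff
      coset_eq_self_iff[OF subspace_max_pow])

lemma rees_kernel_subset: "rees_kernel \<mm> A \<subseteq> rees A"
proof -
  have "\<II> n \<subseteq> ideal_pow class_ring A n" for n
    using idl.subspace_scale[OF subspace_ideal_pow[OF A]]
    by (intro ideal_prod_minimal subspace_ideal_pow A)
  then show ?thesis by (auto simp: rees_def rees_kernel_def)
qed

text \<open>\<open>primeideal\<close> brings the ring axioms of the fiber cone with it; the rest
  follows because \<open>fiber_proj\<close> respects the operations on the Rees algebra.\<close>

lemma rees_prime_vimage: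
  assumes "primeideal P \<FF>"
  shows "rees_prime \<mm> A {p \<in> rees A. fiber_proj \<mm> A p \<in> P}"
proof -
  interpret primeideal P \<FF> by (rule assms)
  show ?thesis
    unfolding rees_prime_def
  proof (intro conjI ballI impI)
    show "1 \<notin> {p \<in> rees A. fiber_proj \<mm> A p \<in> P}"
      using one_imp_carrier I_notcarr by (auto simp: fiber_proj_one)
    fix p q assume p: "p \<in> rees A" and q: "q \<in> rees A"
      and "p * q \<in> {p \<in> rees A. fiber_proj \<mm> A p \<in> P}"
    then have "fiber_proj \<mm> A p \<otimes>\<^bsub>\<FF>\<^esub> fiber_proj \<mm> A q \<in> P" by (simp add: fiber_proj_mult)
    then show "p \<in> {p \<in> rees A. fiber_proj \<mm> A p \<in> P} \<or> q \<in> {p \<in> rees A. fiber_proj \<mm> A p \<in> P}"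
      using I_prime[OF fiber_proj_carrier[OF p] fiber_proj_carrier[OF q]] p q by blast
  qed (use rees_kernel_subset zero_closed a_closed I_l_closed fiber_proj_carrier in
      \<open>auto simp: fiber_proj_kernel fiber_proj_add fiber_proj_mult intro: add_mem_rees mult_mem_rees A\<close>)
qed

end

text \<open>A longer chain of primes pulls back to the Rees algebra, where it is still strict
  because \<open>fiber_proj\<close> is onto, and contradicts
  \<open>no_long_prime_chain\<close>.\<close>

lemma krull_dim_fiber_cone_le:
  assumes A: "idl.subspace A" and fg: "\<And>n. \<exists>S. finite S \<and> idl.span S = ideal_pow class_ring A n"
    and C: "finite C" "C \<subseteq> A"
    and step: "ideal_pow class_ring A (n0 + 1) = ideal_prod class_ring (idl.span C) (ideal_pow class_ring A n0)"
  shows "krull_dim (fiber_cone class_ring \<mm> A) \<le> enat (card C)"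
  unfolding krull_dim_def
proof (rule Sup_least, clarify)
  fix n and P :: "nat \<Rightarrow> (nat \<Rightarrow> 'a set) set"
  assume P: "\<forall>i\<le>n. primeideal (P i) (fiber_cone class_ring \<mm> A)" and chain: "\<forall>i<n. P i \<subset> P (Suc i)"
  show "enat n \<le> enat (card C)"
  proof (rule ccontr)
    assume "\<not> enat n \<le> enat (card C)"
    then have n: "Suc (card C) \<le> n" by simp
    define R where "R i = {p \<in> rees A. fiber_proj \<mm> A p \<in> P i}" for i
    show False
    proof (rule no_long_prime_chain[OF A fg C step])
      show "rees_prime \<mm> A (R i)" if "i \<le> Suc (card C)" for i
        unfolding R_def using P that n by (intro rees_prime_vimage A) auto
      fix i assume "i \<le> card C"
      then have i: "i < n" using n by simp
      then obtain f where f: "f \<in> P (Suc i)" "f \<notin> P i" using chain by blast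
      interpret primeideal "P (Suc i)" "fiber_cone class_ring \<mm> A" using P i by simp
      obtain p where "p \<in> rees A" "fiber_proj \<mm> A p = f"
        using fiber_proj_surj[OF A Icarr[OF f(1)]] by blast
      then show "R i \<subset> R (Suc i)" using f chain i unfolding R_def by blast
    qed
  qed
qed

end

section \<open>Specialization of the testing ideal\<close>

definition monom_eval :: "('v \<Rightarrow> 'a) \<Rightarrow> ('v \<Rightarrow>\<^sub>0 nat) \<Rightarrow> 'a::comm_ring_1" where
  "monom_eval \<alpha> t = (\<Prod>v\<in>Poly_Mapping.keys t. \<alpha> v ^ Poly_Mapping.lookup t v)"

lemma monom_eval_superset:
  assumes "finite K" "Poly_Mapping.keys t \<subseteq> K"
  shows "monom_eval \<alpha> t = (\<Prod>v\<in>K. \<alpha> v ^ Poly_Mapping.lookup t v)"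
  unfolding monom_eval_def
  by (rule prod.mono_neutral_left) (use assms in \<open>auto simp: in_keys_iff\<close>)

lemma monom_eval_add: "monom_eval \<alpha> (s + t) = monom_eval \<alpha> s * monom_eval \<alpha> t"
proof -
  let ?K = "Poly_Mapping.keys s \<union> Poly_Mapping.keys t"
  have "monom_eval \<alpha> (s + t) = (\<Prod>v\<in>?K. \<alpha> v ^ Poly_Mapping.lookup (s + t) v)"
    by (intro monom_eval_superset Poly_Mapping.keys_add) auto
  also have "\<dots> = (\<Prod>v\<in>?K. \<alpha> v ^ Poly_Mapping.lookup s v) * (\<Prod>v\<in>?K. \<alpha> v ^ Poly_Mapping.lookup t v)"
    by (simp add: lookup_add power_add prod.distrib)
  also have "\<dots> = monom_eval \<alpha> s * monom_eval \<alpha> t"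
    by (simp add: monom_eval_superset[of ?K])
  finally show ?thesis .
qed

lemma mpoly_eval_superset:
  assumes "finite K" "Poly_Mapping.keys p \<subseteq> K"
  shows "mpoly_eval \<alpha> p = (\<Sum>t\<in>K. Poly_Mapping.lookup p t * monom_eval \<alpha> t)"
  unfolding mpoly_eval_def monom_eval_def
  by (rule sum.mono_neutral_left) (use assms in \<open>auto simp: in_keys_iff\<close>)

lemma mpoly_eval_single: "mpoly_eval \<alpha> (Poly_Mapping.single t c) = c * monom_eval \<alpha> t"
  using mpoly_eval_superset[of "{t}" "Poly_Mapping.single t c" \<alpha>] by simp

lemma mpoly_eval_add: "mpoly_eval \<alpha> (p + q) = mpoly_eval \<alpha> p + mpoly_eval \<alpha> q"
proof -
  let ?K = "Poly_Mapping.keys p \<union> Poly_Mapping.keys q"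
  have "mpoly_eval \<alpha> (p + q) = (\<Sum>t\<in>?K. Poly_Mapping.lookup (p + q) t * monom_eval \<alpha> t)"
    by (intro mpoly_eval_superset Poly_Mapping.keys_add) auto
  also have "\<dots> = mpoly_eval \<alpha> p + mpoly_eval \<alpha> q"
    by (simp add: lookup_add distrib_right sum.distrib mpoly_eval_superset[of ?K])
  finally show ?thesis .
qed

lemma mpoly_eval_sum: "mpoly_eval \<alpha> (\<Sum>i\<in>S. f i) = (\<Sum>i\<in>S. mpoly_eval \<alpha> (f i))"
  by (induction S rule: infinite_finite_induct) (simp_all add: mpoly_eval_add, simp_all add: mpoly_eval_def)

lemma poly_mapping_eq_sum_single:
  "p = (\<Sum>t\<in>Poly_Mapping.keys p. Poly_Mapping.single t (Poly_Mapping.lookup p t))"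
  by (rule poly_mapping_eqI) (simp add: lookup_sum lookup_single when_def in_keys_iff)

lemma mpoly_eval_mult: "mpoly_eval \<alpha> (p * q) = mpoly_eval \<alpha> p * mpoly_eval \<alpha> q"
proof -
  have "p * q = (\<Sum>s\<in>Poly_Mapping.keys p. Poly_Mapping.single s (Poly_Mapping.lookup p s)) *
      (\<Sum>t\<in>Poly_Mapping.keys q. Poly_Mapping.single t (Poly_Mapping.lookup q t))"
    by (simp flip: poly_mapping_eq_sum_single)
  then show ?thesis
    by (simp add: sum_product mpoly_eval_sum mult_single mpoly_eval_single monom_eval_add)
      (simp add: mpoly_eval_def monom_eval_def sum_product mult_ac)
qed

lemma mpoly_eval_const: "mpoly_eval \<alpha> (mpoly_const c) = c"
  by (simp add: mpoly_const_def mpoly_eval_single monom_eval_def)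

lemma mpoly_eval_var: "mpoly_eval \<alpha> (mpoly_var v) = \<alpha> v"
  by (simp add: mpoly_var_def mpoly_eval_single monom_eval_def)

lemma comm_ring_hom_mpoly_eval: "comm_ring_hom (mpoly_eval \<alpha>)"
proof
  show "mpoly_eval \<alpha> 1 = 1" using mpoly_eval_const[of \<alpha> 1] by (simp add: mpoly_const_def)
  show "mpoly_eval \<alpha> 0 = 0" by (simp add: mpoly_eval_def)
qed (simp_all add: mpoly_eval_add mpoly_eval_mult)

lemma mpoly_eval_generic_element:
  "mpoly_eval (\<lambda>(i, j). \<alpha> i j) (generic_element m a i) = (\<Sum>j<m. \<alpha> i j * a j)"
  by (simp add: generic_element_def mpoly_eval_sum mpoly_eval_mult mpoly_eval_const mpoly_eval_var)

lemma minors_map_mat: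
  assumes "comm_ring_hom f"
  shows "minors h (map_mat f M) = f ` minors h M"
proof -
  have "det (submatrix (map_mat f M) I K) = f (det (submatrix M I K))" for I K
  proof -
    have "submatrix (map_mat f M) I K = map_mat f (submatrix M I K)"
      by (rule eq_matI) (auto simp: submatrix_def pick_le)
    then show ?thesis using comm_ring_hom.hom_det[OF assms] by metis
  qed
  then show ?thesis unfolding minors_def by auto
qed

lemma carrier_mpoly_ring:
  "carrier (mpoly_ring V) = {p. \<forall>t\<in>Poly_Mapping.keys p. Poly_Mapping.keys t \<subseteq> V}"
  by (simp add: mpoly_ring_def)

lemma is_subring_mpoly_ring: "is_subring (carrier (mpoly_ring V :: ('v, 'a::comm_ring_1) mpoly ring))"
  unfolding is_subring_def carrier_mpoly_ring
proof (intro conjI ballI)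
  show "1 \<in> {p :: ('v, 'a) mpoly. \<forall>t\<in>Poly_Mapping.keys p. Poly_Mapping.keys t \<subseteq> V}"
    by simp
  fix p q :: "('v, 'a) mpoly"
  assume pq: "p \<in> {p. \<forall>t\<in>Poly_Mapping.keys p. Poly_Mapping.keys t \<subseteq> V}"
    "q \<in> {p. \<forall>t\<in>Poly_Mapping.keys p. Poly_Mapping.keys t \<subseteq> V}"
  have "Poly_Mapping.keys (p - q) \<subseteq> Poly_Mapping.keys p \<union> Poly_Mapping.keys q"
    by (auto simp: in_keys_iff lookup_minus)
  then show "p - q \<in> {p. \<forall>t\<in>Poly_Mapping.keys p. Poly_Mapping.keys t \<subseteq> V}"
    using pq by blast
  have "Poly_Mapping.keys t \<subseteq> V" if t: "t \<in> Poly_Mapping.keys (p * q)" for t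
  proof -
    obtain s u where "t = s + u" "s \<in> Poly_Mapping.keys p" "u \<in> Poly_Mapping.keys q"
      using subsetD[OF Poly_Mapping.keys_mult t] by blast
    then show ?thesis using pq Poly_Mapping.keys_add[of s u] by fastforce
  qed
  then show "p * q \<in> {p. \<forall>t\<in>Poly_Mapping.keys p. Poly_Mapping.keys t \<subseteq> V}"
    by simp
qed

lemma ring_mpoly_ring: "ring (mpoly_ring V :: ('v, 'a::comm_ring_1) mpoly ring)"
proof -
  have R: "ring (class_ring :: ('v, 'a) mpoly ring)" by (rule class_ring.ring_axioms)
  note sub = is_subringD[OF is_subring_mpoly_ring[of V]]
  have "a_inv class_ring p = - p" for p :: "('v, 'a) mpoly" by (simp only: class_ring_simps)
  then have "subring (carrier (mpoly_ring V)) (class_ring :: ('v, 'a) mpoly ring)"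
    by (intro ring.subringI[OF R]) (simp_all add: sub)
  then have "ring (class_ring\<lparr>carrier := carrier (mpoly_ring V)\<rparr> :: ('v, 'a) mpoly ring)"
    by (rule ring.subring_is_ring[OF R])
  then show ?thesis by (simp add: mpoly_ring_def)
qed

lemma mpoly_ring_ops:
  "p \<oplus>\<^bsub>mpoly_ring V\<^esub> q = p + q" "p \<otimes>\<^bsub>mpoly_ring V\<^esub> q = p * q" "\<zero>\<^bsub>mpoly_ring V\<^esub> = 0"
  by (simp_all add: mpoly_ring_def)

lemma a_inv_mpoly_ring:
  assumes "p \<in> carrier (mpoly_ring V)"
  shows "\<ominus>\<^bsub>mpoly_ring V\<^esub> p = - p"
  using assms is_subringD(3)[OF is_subring_mpoly_ring]
  by (intro abelian_group.minus_equality[OF ring.is_abelian_group[OF ring_mpoly_ring]])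
    (simp_all add: mpoly_ring_ops)

lemma minors_in_subring:
  assumes R: "is_subring R" and M: "elements_mat M \<subseteq> R"
  shows "minors h M \<subseteq> R"
proof
  fix D assume "D \<in> minors h M"
  then obtain I K where IK: "I \<subseteq> {..<dim_row M}" "K \<subseteq> {..<dim_col M}" "card I = h" "card K = h"
    and D: "D = det (submatrix M I K)" by (auto simp: minors_def)
  have dims: "{i. i < dim_row M \<and> i \<in> I} = I" "{j. j < dim_col M \<and> j \<in> K} = K" using IK by auto
  have S: "submatrix M I K \<in> carrier_mat h h" unfolding submatrix_def dims using IK by simp
  have "submatrix M I K $$ (i, j) \<in> R" if "i < h" "j < h" for i j
  proof -
    have "pick I i < dim_row M" "pick K j < dim_col M"
      using pick_in_set_le[of i I] pick_in_set_le[of j K] that IK by auto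
    then have "M $$ (pick I i, pick K j) \<in> elements_mat M" by (intro elements_matI[of M "dim_row M" "dim_col M"]) auto
    then show ?thesis using M that dims IK by (subst submatrix_index) auto
  qed
  then show "D \<in> R"
    unfolding D det_def'[OF S] using is_subringD[OF R]
    by (intro is_subring_sum is_subring_prod is_subringD(6) R)
      (auto simp: sign_def dest: permutes_in_image)
qed

context local_ideal
begin

text \<open>The polynomials with value in \<open>\<mm>\<close> form an ideal, so specialized minors
  in \<open>\<mm>\<close> force all of the specialized \<open>J\<close> into \<open>\<mm>\<close>.
  If a minor has a unit value, its multiples by constants take every value in
  \<open>L\<close>.\<close>

lemma specialize_eq_UNIV_iff:
  fixes M :: "(nat \<times> nat, 'a) mpoly mat"
  assumes M: "elements_mat M \<subseteq> carrier (mpoly_ring V)"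
    and J: "J = genideal (mpoly_ring V) (minors h M)"
  shows "specialize \<alpha> J = UNIV \<longleftrightarrow> \<not> minors h (map_mat (mpoly_eval (\<lambda>(i, j). \<alpha> i j)) M) \<subseteq> \<mm>"
proof -
  let ?ev = "mpoly_eval (\<lambda>(i, j). \<alpha> i j) :: _ \<Rightarrow> 'a"
  interpret hom: comm_ring_hom ?ev by (rule comm_ring_hom_mpoly_eval)
  note sub = is_subringD[OF is_subring_mpoly_ring[of V]]
  have minors: "minors h (map_mat ?ev M) = ?ev ` minors h M"
    by (rule minors_map_mat[OF comm_ring_hom_mpoly_eval])
  show ?thesis
    unfolding minors
  proof
    assume UNIV: "specialize \<alpha> J = UNIV"
    show "\<not> ?ev ` minors h M \<subseteq> \<mm>"
    proof
      assume mem: "?ev ` minors h M \<subseteq> \<mm>"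
      let ?K = "{p \<in> carrier (mpoly_ring V). ?ev p \<in> \<mm>}"
      have "ideal ?K (mpoly_ring V)"
      proof (rule idealI[OF ring_mpoly_ring])
        show "subgroup ?K (add_monoid (mpoly_ring V))"
        proof (rule subgroup.intro)
          show "inv\<^bsub>add_monoid (mpoly_ring V)\<^esub> p \<in> ?K" if "p \<in> ?K" for p
          proof -
            have "inv\<^bsub>add_monoid (mpoly_ring V)\<^esub> p = - p"
              using that by (intro a_inv_mpoly_ring[unfolded a_inv_def]) simp
            then show ?thesis
              using that sub(3)[of p] mult_in[of "?ev p" "- 1"] hom.hom_uminus[of p] by auto
          qed
        qed (use sub zero_in add_in in \<open>auto simp: mpoly_ring_ops mpoly_eval_add hom.hom_zero\<close>)
      qed (use sub mult_in mult_in' in \<open>auto simp: mpoly_ring_ops mpoly_eval_mult\<close>)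
      moreover have "minors h M \<subseteq> ?K"
        using minors_in_subring[OF is_subring_mpoly_ring M] mem by auto
      ultimately have "J \<subseteq> ?K" unfolding J genideal_def by blast
      then have "specialize \<alpha> J \<subseteq> \<mm>" by (auto simp: specialize_def)
      then show False using UNIV one_notin by blast
    qed
  next
    assume "\<not> ?ev ` minors h M \<subseteq> \<mm>"
    then obtain D where D: "D \<in> minors h M" "?ev D \<notin> \<mm>" by blast
    then obtain v where v: "v * ?ev D = 1" using inverse_outside by blast
    have "r \<in> specialize \<alpha> J" for r
    proof -
      have c: "mpoly_const (r * v) \<in> carrier (mpoly_ring V)"
        by (simp add: mpoly_ring_def mpoly_const_def)
      have "mpoly_const (r * v) * D \<in> I" if "ideal I (mpoly_ring V)" "minors h M \<subseteq> I" for I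
        using ideal.I_l_closed[OF that(1) _ c, of D] D(1) that(2) by (auto simp: mpoly_ring_def)
      then have "mpoly_const (r * v) * D \<in> J" unfolding J genideal_def by blast
      moreover have "?ev (mpoly_const (r * v) * D) = r"
        using v by (simp add: mpoly_eval_mult mpoly_eval_const mult.assoc)
      ultimately show ?thesis unfolding specialize_def by (metis image_eqI)
    qed
    then show "specialize \<alpha> J = UNIV" by blast
  qed
qed

text \<open>If a reduction \<open>Q'\<close> does not generate \<open>Q\<close> modulo \<open>\<mm>Q\<close>, then fewer than \<open>d\<close> elements
  generate a reduction, so that the analytic spread would be smaller than \<open>d\<close>.\<close>

lemma reduction_subset_imp_eq:
  assumes A: "idl.subspace A" and fg: "\<And>n. \<exists>S. finite S \<and> idl.span S = ideal_pow class_ring A n"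
    and Y: "finite Y" "card Y \<le> d" "Q = idl.span Y" "Q \<subseteq> A"
    and spread: "analytic_spread class_ring \<mm> A = enat d"
    and Q': "reduction class_ring Q' A" "Q' \<subseteq> Q"
  shows "Q' = Q"
proof -
  obtain n where sub: "idl.subspace Q'" "Q' \<subseteq> A"
    and step: "ideal_pow class_ring A (n + 1) = ideal_prod class_ring Q' (ideal_pow class_ring A n)"
    using Q'(1) by (auto simp: reduction_def ideal_class_ring_iff)
  have Q: "idl.subspace Q" using Y(3) by simp
  \<comment> \<open>\<open>\<mm>Q\<close> and not \<open>\<mm>A\<close>, as Nakayama is to be
    applied to \<open>Q\<close> itself; in the other case it is enlarged to
    \<open>\<mm>A\<close>.\<close>
  let ?N = "ideal_prod class_ring \<mm> Q"
  have N: "idl.subspace ?N" by (intro subspace_ideal_prod subspace_max_ideal Q)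
  have "Y \<subseteq> Q" using Y(3) idl.span_superset by blast
  have "Y \<subseteq> idl.span (Q' \<union> ?N) \<or>
    (\<exists>Y'. finite Y' \<and> Y' \<subseteq> Y \<union> Q' \<and> card Y' < card Y \<and> Q' \<subseteq> idl.span (Y' \<union> ?N))"
  proof (rule idl.span_or_fewer_generators[OF Y(1) sub(1) N])
    show "Q' \<subseteq> idl.span (Y \<union> ?N)" using Q'(2) Y(3) idl.span_mono[of Y "Y \<union> ?N"] by blast
    show "\<mu> * y \<in> ?N" if "\<mu> \<in> \<mm>" "y \<in> Y" for \<mu> y
      using that \<open>Y \<subseteq> Q\<close> by (intro mult_mem_ideal_prod) auto
  qed
  then show ?thesis
  proof
    assume "Y \<subseteq> idl.span (Q' \<union> ?N)"
    then have 1: "Q \<subseteq> idl.span (Q' \<union> ?N)" unfolding Y(3) by (rule idl.span_minimal) simp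
    let ?T = "{\<mu> * x | \<mu> x. \<mu> \<in> \<mm> \<and> x \<in> Q}"
    have "?N \<subseteq> idl.span (?T \<union> Q')"
      by (intro ideal_prod_minimal) (auto intro!: idl.span_base)
    then have "Q' \<union> ?N \<subseteq> idl.span (?T \<union> Q')" using idl.span_superset by blast
    then have 2: "Q \<subseteq> idl.span (?T \<union> Q')"
      using 1 idl.span_minimal[of "Q' \<union> ?N" "idl.span (?T \<union> Q')"] by simp
    have "Q \<subseteq> Q'"
      by (rule idl.nakayama[OF Y(1) \<open>Y \<subseteq> Q\<close> Q sub(1) _ 2]) (use Y(3) idl.span_mono[of Y "Y \<union> Q'"] in blast)
    then show ?thesis using Q'(2) by blast
  next
    assume "\<exists>Y'. finite Y' \<and> Y' \<subseteq> Y \<union> Q' \<and> card Y' < card Y \<and> Q' \<subseteq> idl.span (Y' \<union> ?N)"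
    then obtain Y' where Y': "finite Y'" "Y' \<subseteq> Y \<union> Q'" "card Y' < card Y" "Q' \<subseteq> idl.span (Y' \<union> ?N)"
      by blast
    have Y'A: "Y' \<subseteq> A" using Y'(2) \<open>Y \<subseteq> Q\<close> Y(4) sub(2) by blast
    have "?N \<subseteq> ideal_prod class_ring \<mm> A" by (intro ideal_prod_mono subspace_max_ideal A Y(4)) simp
    then have "Y' \<union> ?N \<subseteq> idl.span Y' \<union> ideal_prod class_ring \<mm> A" using idl.span_superset[of Y'] by blast
    then have "Q' \<subseteq> idl.span (idl.span Y' \<union> ideal_prod class_ring \<mm> A)"
      using Y'(4) idl.span_mono by blast
    then have "ideal_pow class_ring A (n + 1) = ideal_prod class_ring (idl.span Y') (ideal_pow class_ring A n)"
      by (intro reduction_step_mod_max_ideal[OF A fg _ _ _ step] idl.span_minimal Y'A A) auto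
    then have "krull_dim (fiber_cone class_ring \<mm> A) \<le> enat (card Y')"
      by (rule krull_dim_fiber_cone_le[OF A fg Y'(1) Y'A])
    then show ?thesis using spread Y'(3) Y(2) by (simp add: analytic_spread_def)
  qed
qed

end

theorem proposition4p3:
  fixes a :: "nat \<Rightarrow> 'a::comm_ring_1" and m d :: nat and \<mm> A Q :: "'a set"
    and J :: "(nat \<times> nat, 'a) mpoly set" and \<alpha> :: "nat \<Rightarrow> nat \<Rightarrow> 'a"
  assumes "noetherian_ring (class_ring :: 'a ring)"
    and "local_ring (class_ring :: 'a ring) \<mm>"
    and "infinite (carrier ((class_ring :: 'a ring) Quot \<mm>))"
    and "A = ideal_gen_by m a"
    and "analytic_spread class_ring \<mm> A = enat d"
    and "testing_ideal d m a J"
    and "Q = parameterized_ideal d m a \<alpha>"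
  shows "minimal_reduction class_ring Q A \<longleftrightarrow> specialize \<alpha> J = carrier class_ring"
proof -
  interpret local_ideal \<mm> by (rule local_ring_imp_local_ideal[OF assms(2)])
  let ?ev = "mpoly_eval (\<lambda>(i, j). \<alpha> i j) :: _ \<Rightarrow> 'a"
  define r where "r = big_reduction_number class_ring A"
  define c where "c i = (\<Sum>j<m. \<alpha> i j * a j)" for i
  have A: "idl.subspace A" unfolding assms(4) by (rule subspace_ideal_gen_by)
  have fg: "\<exists>S. finite S \<and> idl.span S = ideal_pow class_ring A n" for n
    using noetherian_ideal_finitely_generated[OF assms(1) subspace_ideal_pow[OF A]] by metis
  have Q: "Q = ideal_gen_by d c" unfolding assms(7) parameterized_ideal_def c_def by simp
  then have subQ: "idl.subspace Q" by (simp add: subspace_ideal_gen_by)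
  have c: "c i \<in> A" for i
    unfolding c_def assms(4) ideal_gen_by_eq_span by (intro idl.span_sum idl.span_scale idl.span_base) auto
  have QA: "Q \<subseteq> A"
    unfolding Q ideal_gen_by_eq_span using c by (intro idl.span_minimal A) auto
  let ?step = "\<lambda>Q n. ideal_pow class_ring A (n + 1) = ideal_prod class_ring Q (ideal_pow class_ring A n)"
  obtain B rs M where tm: "testing_matrix d m a B rs M"
    and J: "J = genideal (mpoly_ring ({..<d} \<times> {..<m}))
      (minors (min_num_gens class_ring (ideal_pow class_ring A (r + 1))) M)"
    using assms(6) unfolding testing_ideal_def Let_def r_def assms(4) by blast
  have B: "minimal_basis class_ring (ideal_pow class_ring A (r + 1)) B"
    and rs: "set rs = {..<d} \<times> multisets_of_size {..<m} r"
    and M: "M \<in> carrier_mat (length rs) (length B)"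
    and elements: "elements_mat M \<subseteq> carrier (mpoly_ring ({..<d} \<times> {..<m}))"
    and rows: "\<And>p. p < length rs \<Longrightarrow>
      generic_element m a (fst (rs ! p)) * mpoly_const (monomial_value a (snd (rs ! p)))
        = (\<Sum>k<length B. M $$ (p, k) * mpoly_const (B ! k))"
    using tm unfolding testing_matrix_def Let_def r_def assms(4) by blast+
  have "?step Q r \<longleftrightarrow> \<not> minors (length B) (map_mat ?ev M) \<subseteq> \<mm>"
    unfolding Q assms(4)
  proof (rule reduction_step_iff_minor[symmetric, OF _ rs])
    show "minimal_basis class_ring (ideal_pow class_ring (ideal_gen_by m a) (r + 1)) B"
      using B unfolding assms(4) .
    show "map_mat ?ev M \<in> carrier_mat (length rs) (length B)" using M by simp
    show "c i \<in> ideal_gen_by m a" for i using c unfolding assms(4) .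
    fix p assume p: "p < length rs"
    \<comment> \<open>Evaluation at \<open>\<alpha>\<close> is a ring homomorphism and turns the
      generic relation defining the row into one over \<open>L\<close>.\<close>
    from arg_cong[OF rows[OF p], of ?ev]
    show "c (fst (rs ! p)) * monomial_value a (snd (rs ! p))
        = (\<Sum>k<length B. map_mat ?ev M $$ (p, k) * B ! k)"
      using M p by (simp add: mpoly_eval_mult mpoly_eval_sum mpoly_eval_const mpoly_eval_generic_element c_def)
  qed
  also have "\<dots> \<longleftrightarrow> specialize \<alpha> J = UNIV"
    unfolding length_minimal_basis[OF B]
    by (rule specialize_eq_UNIV_iff[OF elements J, symmetric])
  finally have iff: "specialize \<alpha> J = UNIV \<longleftrightarrow> ?step Q r" by blast
  have "minimal_reduction class_ring Q A \<longleftrightarrow> ?step Q r"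
  proof
    assume min: "minimal_reduction class_ring Q A"
    \<comment> \<open>\<open>Max\<close> dominates the members of \<open>RN\<close> because the
      uniform bound \<open>N\<close> makes \<open>RN\<close> finite.\<close>
    define RN where "RN = {reduction_number class_ring Q A | Q. minimal_reduction class_ring Q A}"
    obtain N where N: "\<And>Q. reduction class_ring Q A \<Longrightarrow> \<exists>n\<le>N. ?step Q n"
      using reduction_numbers_bounded[OF assms(1), of m a] unfolding assms(4) by blast
    have "RN \<subseteq> {..N}"
    proof
      fix k assume "k \<in> RN"
      then obtain Q where "reduction class_ring Q A" and k: "k = reduction_number class_ring Q A"
        by (auto simp: RN_def minimal_reduction_def)
      with N obtain n where "n \<le> N" "?step Q n" by blast
      then show "k \<in> {..N}" unfolding k reduction_number_def by (auto intro: Least_le order_trans)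
    qed
    then have "finite RN" by (rule finite_subset) simp
    then have "reduction_number class_ring Q A \<le> r"
      unfolding r_def big_reduction_number_def RN_def[symmetric] using min by (intro Max_ge) (auto simp: RN_def)
    moreover have "?step Q (reduction_number class_ring Q A)"
    proof -
      obtain n where "?step Q n" using min by (auto simp: minimal_reduction_def reduction_def)
      then show ?thesis unfolding reduction_number_def by (rule LeastI)
    qed
    \<comment> \<open>The equation persists from the reduction number of \<open>Q\<close> up to
      \<open>r\<close>.\<close>
    ultimately show "?step Q r" using reduction_step_Suc[OF A subQ] by blast
  next
    assume step: "?step Q r"
    show "minimal_reduction class_ring Q A"
      unfolding minimal_reduction_def
    proof (intro conjI allI impI)
      show "reduction class_ring Q A"
        unfolding reduction_def ideal_class_ring_iff using subQ QA step by blast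
      fix Q' assume Q': "reduction class_ring Q' A \<and> Q' \<subseteq> Q"
      show "Q' = Q"
      proof (rule reduction_subset_imp_eq[OF A fg _ _ _ QA assms(5)])
        show "Q = idl.span (c ` {..<d})" unfolding Q by (rule ideal_gen_by_eq_span)
        show "card (c ` {..<d}) \<le> d" using card_image_le[of "{..<d}" c] by simp
      qed (use Q' in auto)
    qed
  qed
  then show ?thesis unfolding iff[symmetric] by simp
qed

end
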